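(* Let $K$ be a field with $\operatorname{char}(K)=p>0$ and let $G$ be a nilpotent group such that $|G'|=p^n$. (i) If $p=2$ and $t_L(KG)<2^n+1$, then $t_L(KG)\leq 2^n$. (ii) If $p=3$ and $t_L(KG)<3^n+1$, then $t_L(KG)\leq 3^n-1$.
   Context: For an associative algebra $R$ with identity put $[x,y]=xy-yx$ and $[x_1,\ldots,x_n]=[[x_1,\ldots,x_{n-1}],x_n]$. The lower Lie powers of $R$ are $R^{[1]}=R$ and, for $n\ge 2$, $R^{[n]}$ is the two-sided associative ideal generated by all Lie commutators $[x_1,\ldots,x_n]$ with $x_i\in R$. The Lie nilpotency index $t_L(R)$ is the minimal integer $m$ with $R^{[m]}=0$. $KG$ is the group algebra of $G$ over $K$ and $G'$ is the commutator subgroup of $G$. (Known fact: under these hypotheses on $K$ and $G$, $KG$ is Lie nilpotent, so $t_L(KG)$ is finite.) *)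

theory Defs
  imports "HOL-Algebra.Algebra"
begin

definition ring_char :: "('k, 'c) ring_scheme \<Rightarrow> nat" where
  "ring_char K =
     (if \<exists>m>0::nat. add_pow K m \<one>\<^bsub>K\<^esub> = \<zero>\<^bsub>K\<^esub>
      then LEAST m::nat. 0 < m \<and> add_pow K m \<one>\<^bsub>K\<^esub> = \<zero>\<^bsub>K\<^esub>
      else 0)"

text \<open>The series is indexed from 0: the \<open>i\<close>-th entry is \<open>\<gamma>\<^bsub>i+1\<^esub>(G)\<close>.\<close>

primrec lower_central :: "('g, 'd) monoid_scheme \<Rightarrow> nat \<Rightarrow> 'g set" where
  "lower_central G 0 = carrier G"
| "lower_central G (Suc i) =
     generate G {a \<otimes>\<^bsub>G\<^esub> b \<otimes>\<^bsub>G\<^esub> inv\<^bsub>G\<^esub> a \<otimes>\<^bsub>G\<^esub> inv\<^bsub>G\<^esub> b | a b. a \<in> lower_central G i \<and> b \<in> carrier G}"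

definition nilpotent_group :: "('g, 'd) monoid_scheme \<Rightarrow> bool" where
  "nilpotent_group G \<longleftrightarrow> group G \<and> (\<exists>c. lower_central G c = {\<one>\<^bsub>G\<^esub>})"

text \<open>An element \<open>\<Sum> f(g) g\<close> of the group algebra is represented by its finitely supported
  coefficient function \<open>f\<close>, taken to be \<open>undefined\<close> outside the carrier of \<open>G\<close>, so that equality
  of elements is equality of functions. Multiplication is convolution,
  \<open>(f h)(x) = \<Sum>\<^sub>y f(y) h(y\<^sup>-\<^sup>1 x)\<close>; the sum is cut down to the (finite) support of \<open>f\<close> because
  \<^const>\<open>finsum\<close> carries no information over infinite index sets.\<close>

definition group_algebra ::
    "('k, 'c) ring_scheme \<Rightarrow> ('g, 'd) monoid_scheme \<Rightarrow> ('g \<Rightarrow> 'k) ring" where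
  "group_algebra K G =
     \<lparr> carrier = {f \<in> carrier G \<rightarrow>\<^sub>E carrier K. finite {y \<in> carrier G. f y \<noteq> \<zero>\<^bsub>K\<^esub>}},
       monoid.mult = (\<lambda>f h. \<lambda>x\<in>carrier G.
         \<Oplus>\<^bsub>K\<^esub> y \<in> {y \<in> carrier G. f y \<noteq> \<zero>\<^bsub>K\<^esub>}. f y \<otimes>\<^bsub>K\<^esub> h (inv\<^bsub>G\<^esub> y \<otimes>\<^bsub>G\<^esub> x)),
       monoid.one = (\<lambda>x\<in>carrier G. if x = \<one>\<^bsub>G\<^esub> then \<one>\<^bsub>K\<^esub> else \<zero>\<^bsub>K\<^esub>),
       ring.zero = (\<lambda>x\<in>carrier G. \<zero>\<^bsub>K\<^esub>),
       ring.add = (\<lambda>f h. \<lambda>x\<in>carrier G. f x \<oplus>\<^bsub>K\<^esub> h x) \<rparr>"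

definition lie_bracket :: "('a, 'c) ring_scheme \<Rightarrow> 'a \<Rightarrow> 'a \<Rightarrow> 'a" where
  "lie_bracket R x y = x \<otimes>\<^bsub>R\<^esub> y \<ominus>\<^bsub>R\<^esub> y \<otimes>\<^bsub>R\<^esub> x"

text \<open>\<open>foldl (lie_bracket R) x [x\<^sub>2, \<dots>, x\<^sub>m]\<close> is the left-normed commutator
  \<open>[x, x\<^sub>2, \<dots>, x\<^sub>m]\<close>.\<close>

definition lie_commutators :: "('a, 'c) ring_scheme \<Rightarrow> nat \<Rightarrow> 'a set" where
  "lie_commutators R m =
     {foldl (lie_bracket R) x xs | x xs.
        x \<in> carrier R \<and> set xs \<subseteq> carrier R \<and> Suc (length xs) = m}"

text \<open>Only indices \<open>m \<ge> 1\<close> are meaningful; the value at 0 is a dummy.\<close>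

definition lower_lie_power :: "('a, 'c) ring_scheme \<Rightarrow> nat \<Rightarrow> 'a set" where
  "lower_lie_power R m =
     (if m \<le> 1 then carrier R else genideal R (lie_commutators R m))"

text \<open>Unspecified if \<open>R\<close> is not Lie nilpotent.\<close>

definition lie_nilpotency_index :: "('a, 'c) ring_scheme \<Rightarrow> nat" where
  "lie_nilpotency_index R = (LEAST m. 1 \<le> m \<and> lower_lie_power R m = {\<zero>\<^bsub>R\<^esub>})"

end

(*
  A two-sided ideal is generated by Lie commutators of length m, so it vanishes iff these commutators
  do. Let p = 3 and G' have order 3^n. If N < B are normal in G and B/N is central of order 3,
  generated by z, then z - 1 is central of cube zero modulo the relative augmentation ideal of N, so
  if commutators of length m lie in the ideal of B, those of length 1 + 3(m - 1) lie in the ideal of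
  N. Descending from G' in such steps bounds the index by 3^n + 1.

  If G' is cyclic, generated by a commutator x = (a,b), then with u = x - 1 the commutator
  [b,a,...,a] with k entries a is, up to sign, u^k b a^k modulo u^(k+1), and this is nonzero for
  k = 3^n - 1; so the index is exactly 3^n + 1. If G' is not cyclic, some step of the descent first
  meets a noncyclic quotient G'/N, generated by x of order 3^k modulo N and a central z of order 3.
  There the filtration giving x - 1 weight 1 and z - 1 weight 2 kills all commutators of length
  3^k + 5 <= 3^(k+1) - 1, and the remaining steps keep the index at most 3^n - 1.
*)
theory Submission
  imports Defs
begin

text \<open>The point is to exclude the single value 3^n: the index either is 3^n + 1 or drops to at
  most 3^n - 1. A descent step turns a bound 3^k + 1 into exactly 3^(k+1) + 1, but a bound 3^k - 1
  into 3^(k+1) - 5, so a gain once made survives every later step. The weight 2 of z - 1 is a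
  compromise. Modulo N every (x,g) is the cube of a power of x times a power of z, so brackets with
  x - 1 involve (x - 1)^3 and z - 1. A bracket must lift weight 1 to at least 2, hence z - 1 cannot
  have weight 1; a larger weight would only delay vanishing. The heaviest monomial that can be
  nonzero, (x - 1)^(3^k - 1) (z - 1)^2, has weight 3^k + 3, which is the origin of 3^k + 5; for k =
  1 this equals 3^(k+1) - 1, so there is no room to spare. The same cubes carry the lower bound:
  they lift the terms dropped from [b,a,...,a] high enough to be errors. That they are cubes comes
  from a normal subgroup of index 3 in G' containing (G',G), chosen at the first step and kept
  throughout.\<close>

section \<open>Lie commutators in rings\<close>

context ring
begin

lemma lie_bracket_closed [intro, simp]:
  "\<lbrakk>x \<in> carrier R; y \<in> carrier R\<rbrakk> \<Longrightarrow> lie_bracket R x y \<in> carrier R"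
  by (simp add: lie_bracket_def)

lemma lie_bracket_zero_left [simp]: "y \<in> carrier R \<Longrightarrow> lie_bracket R \<zero> y = \<zero>"
  by (simp add: lie_bracket_def a_minus_def)

lemma lie_bracket_one_left [simp]: "y \<in> carrier R \<Longrightarrow> lie_bracket R \<one> y = \<zero>"
  by (simp add: lie_bracket_def)

lemma lie_bracket_add_left:
  "\<lbrakk>x \<in> carrier R; y \<in> carrier R; z \<in> carrier R\<rbrakk> \<Longrightarrow>
    lie_bracket R (x \<oplus> y) z = lie_bracket R x z \<oplus> lie_bracket R y z"
  unfolding lie_bracket_def by algebra

lemma lie_bracket_add_right:
  "\<lbrakk>x \<in> carrier R; y \<in> carrier R; z \<in> carrier R\<rbrakk> \<Longrightarrow>
    lie_bracket R z (x \<oplus> y) = lie_bracket R z x \<oplus> lie_bracket R z y"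
  unfolding lie_bracket_def by algebra

lemma lie_bracket_mult_left:
  assumes "x \<in> carrier R" "y \<in> carrier R" "z \<in> carrier R"
  shows "lie_bracket R (x \<otimes> y) z = x \<otimes> lie_bracket R y z \<oplus> lie_bracket R x z \<otimes> y"
proof -
  have "x \<otimes> y \<otimes> z \<ominus> z \<otimes> (x \<otimes> y)
      = (x \<otimes> y \<otimes> z \<ominus> x \<otimes> z \<otimes> y) \<oplus> (x \<otimes> z \<otimes> y \<ominus> z \<otimes> x \<otimes> y)"
    using assms by algebra
  then show ?thesis
    unfolding lie_bracket_def using assms by algebra
qed

lemma lie_bracket_minus_one_left:
  "\<lbrakk>x \<in> carrier R; y \<in> carrier R\<rbrakk> \<Longrightarrow> lie_bracket R (x \<ominus> \<one>) y = lie_bracket R x y"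
  by (simp add: lie_bracket_def a_minus_def l_distr r_distr l_minus r_minus minus_add a_ac r_neg2)

section \<open>Left-normed commutators, ideals and filtrations\<close>

lemma foldl_lie_bracket_mem:
  assumes "x \<in> S" "set xs \<subseteq> carrier R"
    and "\<And>y r. \<lbrakk>y \<in> S; r \<in> carrier R\<rbrakk> \<Longrightarrow> lie_bracket R y r \<in> S"
  shows "foldl (lie_bracket R) x xs \<in> S"
  using assms by (induction xs arbitrary: x) auto

lemma lie_commutators_closed: "lie_commutators R m \<subseteq> carrier R"
  unfolding lie_commutators_def by (auto intro!: foldl_lie_bracket_mem)

lemma lie_commutators_add:
  assumes "0 < m"
  shows "lie_commutators R (m + k) =
    {foldl (lie_bracket R) c ys | c ys.
       c \<in> lie_commutators R m \<and> set ys \<subseteq> carrier R \<and> length ys = k}" (is "?L = ?R")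
proof
  show "?L \<subseteq> ?R"
  proof
    fix c assume "c \<in> ?L"
    then obtain x xs where x: "x \<in> carrier R" "set xs \<subseteq> carrier R"
      "Suc (length xs) = m + k" "c = foldl (lie_bracket R) x xs"
      unfolding lie_commutators_def by auto
    \<comment> \<open>Together with the head \<open>x\<close>, m - 1 entries make a commutator of
      length m.\<close>
    let ?a = "take (m - 1) xs" and ?b = "drop (m - 1) xs"
    have "c = foldl (lie_bracket R) (foldl (lie_bracket R) x ?a) ?b"
      using x(4) by (metis append_take_drop_id foldl_append)
    moreover have "foldl (lie_bracket R) x ?a \<in> lie_commutators R m"
      unfolding lie_commutators_def using x assms by (auto dest: in_set_takeD intro!: exI[of _ x] exI[of _ ?a])
    moreover have "set ?b \<subseteq> carrier R" "length ?b = k"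
      using x assms by (auto dest: in_set_dropD)
    ultimately show "c \<in> ?R" by blast
  qed
  show "?R \<subseteq> ?L"
  proof clarify
    fix c ys assume c: "c \<in> lie_commutators R m" "set ys \<subseteq> carrier R" "k = length ys"
    then obtain x xs where "x \<in> carrier R" "set xs \<subseteq> carrier R"
      "Suc (length xs) = m" "c = foldl (lie_bracket R) x xs"
      unfolding lie_commutators_def by auto
    then show "foldl (lie_bracket R) c ys \<in> lie_commutators R (m + length ys)"
      unfolding lie_commutators_def using c
      by (auto intro!: exI[of _ x] exI[of _ "xs @ ys"])
  qed
qed

text \<open>A longer left-normed commutator starts with a shorter one, and an ideal absorbs the
  remaining brackets.\<close>

lemma lie_commutators_mono:
  assumes I: "ideal I R" and "0 < m" "m \<le> m'" "lie_commutators R m \<subseteq> I"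
  shows "lie_commutators R m' \<subseteq> I"
proof -
  interpret ideal I R by (rule I)
  have br: "lie_bracket R y r \<in> I" if "y \<in> I" "r \<in> carrier R" for y r
    unfolding lie_bracket_def a_minus_def using that by (simp add: I_l_closed I_r_closed)
  obtain k where k: "m' = m + k" using assms(3) le_Suc_ex by blast
  show ?thesis
    unfolding k lie_commutators_add[OF assms(2)]
    using assms(4) by (auto intro!: foldl_lie_bracket_mem br)
qed

text \<open>Length w + 1 means w brackets, each raising the filtration by one; hence the shift
  between length and weight.\<close>

lemma lie_commutators_filtration:
  assumes "J 0 = carrier R"
    and J: "\<And>w x r. \<lbrakk>x \<in> J w; r \<in> carrier R\<rbrakk> \<Longrightarrow> lie_bracket R x r \<in> J (Suc w)"
  shows "lie_commutators R (Suc w) \<subseteq> J w"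
proof (induction w)
  case 0
  show ?case using lie_commutators_closed assms by blast
next
  case (Suc w)
  show ?case
    using Suc lie_commutators_add[of "Suc w" 1] by (auto simp: length_Suc_conv intro!: J)
qed

text \<open>Centrality of v makes the right ideal vR two-sided, so that containment of another ideal
  can be tested on generators.\<close>

lemma central_multiples_ideal:
  assumes v: "v \<in> carrier R" "\<And>r. r \<in> carrier R \<Longrightarrow> lie_bracket R v r = \<zero>"
  shows "ideal {v \<otimes> s | s. s \<in> carrier R} R"
proof (rule idealI[OF ring_axioms])
  show "subgroup {v \<otimes> s | s. s \<in> carrier R} (add_monoid R)"
  proof (rule add.subgroupI)
    fix x assume "x \<in> {v \<otimes> s | s. s \<in> carrier R}"
    then obtain s where "s \<in> carrier R" "x = v \<otimes> s" by blast
    then show "\<ominus> x \<in> {v \<otimes> s | s. s \<in> carrier R}"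
      using v(1) by (auto simp: r_minus[symmetric])
  next
    fix x y assume "x \<in> {v \<otimes> s | s. s \<in> carrier R}" "y \<in> {v \<otimes> s | s. s \<in> carrier R}"
    then obtain s t where "s \<in> carrier R" "x = v \<otimes> s" "t \<in> carrier R" "y = v \<otimes> t" by blast
    then show "x \<oplus> y \<in> {v \<otimes> s | s. s \<in> carrier R}"
      using v(1) by (auto simp: r_distr[symmetric])
  qed (use v in auto)
next
  fix x r assume "x \<in> {v \<otimes> s | s. s \<in> carrier R}" and r: "r \<in> carrier R"
  then obtain s where s: "s \<in> carrier R" "x = v \<otimes> s" by blast
  have "v \<otimes> r = r \<otimes> v" using v(2)[OF r] v(1) r by (auto simp: lie_bracket_def)
  then have "r \<otimes> x = v \<otimes> (r \<otimes> s)" using v(1) r s by (simp add: m_assoc[symmetric])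
  then show "r \<otimes> x \<in> {v \<otimes> s | s. s \<in> carrier R}" using r s by blast
  have "x \<otimes> r = v \<otimes> (s \<otimes> r)" using v(1) r s by (simp add: m_assoc)
  then show "x \<otimes> r \<in> {v \<otimes> s | s. s \<in> carrier R}" using r s by blast
qed

text \<open>A central v can be pulled out of a commutator, and the cofactor starts a new one: every
  block of m - 1 brackets yields one more factor v.\<close>

lemma lie_commutators_central:
  assumes v: "v \<in> carrier R" "\<And>r. r \<in> carrier R \<Longrightarrow> lie_bracket R v r = \<zero>"
    and m: "0 < m" "\<And>c. c \<in> lie_commutators R m \<Longrightarrow> \<exists>r \<in> carrier R. c = v \<otimes> r"
    and c: "c \<in> lie_commutators R (Suc (e * (m - 1)))"
  shows "\<exists>r \<in> carrier R. c = v [^] e \<otimes> r"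
  using c
proof (induction e arbitrary: c)
  case 0
  then show ?case using lie_commutators_closed by auto
next
  case (Suc e)
  have vc: "lie_bracket R (v [^] k) r = \<zero>" if "r \<in> carrier R" for r and k :: nat
    using that v by (induction k) (auto simp: lie_bracket_mult_left)
  have pull: "foldl (lie_bracket R) (v [^] e \<otimes> r) ys = v [^] e \<otimes> foldl (lie_bracket R) r ys"
    if "r \<in> carrier R" "set ys \<subseteq> carrier R" for r ys
    using that
  proof (induction ys arbitrary: r)
    case (Cons y ys)
    then show ?case using v vc by (simp add: lie_bracket_mult_left)
  qed simp
  have "c \<in> lie_commutators R (Suc (e * (m - 1)) + (m - 1))"
    using Suc.prems by (simp add: add.commute)
  then obtain d ys where d: "d \<in> lie_commutators R (Suc (e * (m - 1)))" "set ys \<subseteq> carrier R"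
      "length ys = m - 1" "c = foldl (lie_bracket R) d ys"
    unfolding lie_commutators_add[OF zero_less_Suc] by blast
  obtain r where r: "r \<in> carrier R" "d = v [^] e \<otimes> r" using Suc.IH[OF d(1)] by blast
  \<comment> \<open>The cofactor \<open>r\<close> is an arbitrary ring element, so it may serve as
    first entry of a commutator of length m.\<close>
  have "foldl (lie_bracket R) r ys \<in> lie_commutators R m"
    unfolding lie_commutators_def using d r m(1) by (auto intro!: exI[of _ r] exI[of _ ys])
  then obtain s where s: "s \<in> carrier R" "foldl (lie_bracket R) r ys = v \<otimes> s" using m(2) by blast
  have "c = v [^] e \<otimes> (v \<otimes> s)" using d r s pull by simp
  also have "\<dots> = v [^] Suc e \<otimes> s" using v s by (simp add: m_assoc)
  finally show ?case using s by blast
qed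

text \<open>The right ideal generated by all u^i v^j of weight i + 2 j at least w. Powers of u stand
  on the left because u need not be central; left multiplication has to be handled through
  brackets.\<close>

inductive_set weight_filtration :: "'a \<Rightarrow> 'a \<Rightarrow> nat \<Rightarrow> 'a set" for u v w where
  zero: "\<zero> \<in> weight_filtration u v w"
| add: "\<lbrakk>x \<in> weight_filtration u v w; y \<in> weight_filtration u v w\<rbrakk> \<Longrightarrow> x \<oplus> y \<in> weight_filtration u v w"
| gen: "\<lbrakk>w \<le> i + 2 * j; r \<in> carrier R\<rbrakk> \<Longrightarrow> u [^] i \<otimes> (v [^] j \<otimes> r) \<in> weight_filtration u v w"

context
  fixes u v
  assumes u [simp]: "u \<in> carrier R" and v [simp]: "v \<in> carrier R"
    and v_central: "\<And>r. r \<in> carrier R \<Longrightarrow> lie_bracket R v r = \<zero>"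
begin

private abbreviation "J \<equiv> weight_filtration u v"

lemma weight_filtration_closed: "x \<in> J w \<Longrightarrow> x \<in> carrier R"
  by (induction rule: weight_filtration.induct) auto

lemma weight_filtration_mono: "x \<in> J w \<Longrightarrow> w' \<le> w \<Longrightarrow> x \<in> J w'"
  by (induction rule: weight_filtration.induct) (auto intro: weight_filtration.intros)

lemma weight_filtration_0: "J 0 = carrier R"
proof
  show "carrier R \<subseteq> J 0"
  proof
    fix r assume "r \<in> carrier R"
    then show "r \<in> J 0" using weight_filtration.gen[of 0 0 0 r u v] by simp
  qed
qed (use weight_filtration_closed in blast)

lemma v_pow_commute:
  assumes r: "r \<in> carrier R"
  shows "v [^] (j::nat) \<otimes> r = r \<otimes> v [^] j"
proof (induction j)
  case (Suc j)
  have "v \<otimes> r = r \<otimes> v"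
    using v_central[OF r] r by (auto simp: lie_bracket_def)
  then have "v [^] j \<otimes> v \<otimes> r = v [^] j \<otimes> r \<otimes> v" using r by (simp add: m_assoc)
  then show ?case using Suc r by (simp add: m_assoc)
qed (simp add: r)

text \<open>The central v^j moves past powers of u, so exponents and hence weights add.\<close>

lemma weight_filtration_pow_mult: "x \<in> J w \<Longrightarrow> u [^] (i::nat) \<otimes> (v [^] (j::nat) \<otimes> x) \<in> J (i + 2 * j + w)"
proof (induction rule: weight_filtration.induct)
  case zero
  then show ?case by (simp add: weight_filtration.zero)
next
  case (add x z)
  then show ?case using weight_filtration_closed by (simp add: r_distr weight_filtration.add)
next
  case (gen i' j' s)
  have "u [^] i \<otimes> (v [^] j \<otimes> (u [^] i' \<otimes> (v [^] j' \<otimes> s)))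
      = u [^] i \<otimes> (u [^] i' \<otimes> (v [^] j \<otimes> (v [^] j' \<otimes> s)))"
    using gen v_pow_commute[of "u [^] i'" j] by (simp add: m_assoc[symmetric])
  also have "\<dots> = u [^] (i + i') \<otimes> (v [^] (j + j') \<otimes> s)"
    using gen by (simp add: nat_pow_mult[symmetric] m_assoc)
  finally show ?case
    using gen by (simp add: weight_filtration.gen)
qed

text \<open>\<open>J b\<close> is only known as a right ideal, and the coefficient r of a monomial
  of x meets y from the left; hence the hypothesis on all left multiples of y.\<close>

lemma weight_filtration_mult:
  assumes "x \<in> J a" and y: "y \<in> carrier R" "\<And>s. s \<in> carrier R \<Longrightarrow> s \<otimes> y \<in> J b"
  shows "x \<otimes> y \<in> J (a + b)"
  using assms(1)
proof (induction rule: weight_filtration.induct)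
  case zero
  then show ?case using y by (simp add: weight_filtration.zero)
next
  case (add x z)
  then show ?case using y weight_filtration_closed by (simp add: l_distr weight_filtration.add)
next
  case (gen i j r)
  have "u [^] i \<otimes> (v [^] j \<otimes> (r \<otimes> y)) \<in> J (a + b)"
    using weight_filtration_pow_mult[OF y(2)[OF gen(2)], of i j]
    by (rule weight_filtration_mono) (use gen in linarith)
  then show ?case using gen y by (simp add: m_assoc)
qed

lemma weight_filtration_mult_right: "x \<in> J w \<Longrightarrow> r \<in> carrier R \<Longrightarrow> x \<otimes> r \<in> J w"
  using weight_filtration_mult[of x w r 0] by (simp add: weight_filtration_0)

lemma weight_filtration_minus: "x \<in> J w \<Longrightarrow> \<ominus> x \<in> J w"
  using weight_filtration_mult_right[of x w "\<ominus> \<one>"] weight_filtration_closed by (simp add: r_minus)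

section \<open>Filtrations that every Lie bracket lifts by one weight\<close>

context
  fixes d :: nat
  assumes d: "0 < d"
    and u_bracket: "\<And>r. r \<in> carrier R \<Longrightarrow> lie_bracket R u r \<in> J (Suc d)"
    and bracket: "\<And>r s. \<lbrakk>r \<in> carrier R; s \<in> carrier R\<rbrakk> \<Longrightarrow> lie_bracket R r s \<in> J 1"
begin

text \<open>The number d measures how far a bracket lifts u. It will be 1 when cubes of x come
  together with powers of z, and 2 when only cubes occur. By the Leibniz rule the lift carries over
  to powers of u.\<close>

lemma weight_filtration_pow_bracket:
  "r \<in> carrier R \<Longrightarrow> lie_bracket R (u [^] (i::nat)) r \<in> J (i + d)"
proof (induction i arbitrary: r)
  case 0
  then show ?case by (simp add: weight_filtration.zero)
next
  case (Suc i)
  \<comment> \<open>Moving s past u^i costs the bracket [u^i, s], which the induction hypothesis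
    controls; this is why r is kept arbitrary.\<close>
  have sw: "s \<otimes> u [^] i \<in> J i" if s: "s \<in> carrier R" for s
  proof -
    have "s \<otimes> u [^] i = u [^] i \<otimes> (v [^] (0::nat) \<otimes> s) \<oplus> \<ominus> lie_bracket R (u [^] i) s"
      unfolding lie_bracket_def using s nat_pow_closed[OF u, of i] by (simp add: ring_simprules)
    moreover have "u [^] i \<otimes> (v [^] (0::nat) \<otimes> s) \<in> J i"
      using s by (intro weight_filtration.gen) auto
    moreover have "\<ominus> lie_bracket R (u [^] i) s \<in> J i"
      using Suc.IH[OF s] by (auto intro: weight_filtration_minus weight_filtration_mono)
    ultimately show ?thesis by (simp add: weight_filtration.add)
  qed
  have "u [^] Suc i = u \<otimes> u [^] i" by (rule nat_pow_Suc2) simp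
  then have "lie_bracket R (u [^] Suc i) r
      = u [^] (1::nat) \<otimes> (v [^] (0::nat) \<otimes> lie_bracket R (u [^] i) r) \<oplus> lie_bracket R u r \<otimes> u [^] i"
    using Suc.prems by (simp add: lie_bracket_mult_left)
  moreover have "u [^] (1::nat) \<otimes> (v [^] (0::nat) \<otimes> lie_bracket R (u [^] i) r) \<in> J (Suc i + d)"
    using weight_filtration_pow_mult[OF Suc.IH[OF Suc.prems], of 1 0] by simp
  moreover have "lie_bracket R u r \<otimes> u [^] i \<in> J (Suc d + i)"
    using weight_filtration_mult[OF u_bracket[OF Suc.prems] _ sw] by simp
  ultimately show ?case by (simp add: weight_filtration.add add.commute)
qed

text \<open>Leibniz on u^i v^j s: the central v contributes nothing, the bracket falling on s gains
  one weight, the one falling on u^i gains d >= 1.\<close>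

lemma weight_filtration_bracket:
  assumes "x \<in> J w" and r: "r \<in> carrier R"
  shows "lie_bracket R x r \<in> J (Suc w)"
  using assms(1)
proof (induction rule: weight_filtration.induct)
  case zero
  then show ?case using r by (simp add: weight_filtration.zero)
next
  case (add x y)
  then show ?case
    using r weight_filtration_closed by (simp add: lie_bracket_add_left weight_filtration.add)
next
  case (gen i j s)
  have "lie_bracket R (v [^] j) r = \<zero>"
    using v_pow_commute[OF r] r by (simp add: lie_bracket_def)
  then have eq: "lie_bracket R (u [^] i \<otimes> (v [^] j \<otimes> s)) r
      = u [^] i \<otimes> (v [^] j \<otimes> lie_bracket R s r) \<oplus> lie_bracket R (u [^] i) r \<otimes> (v [^] j \<otimes> s)"
    using gen r by (simp add: lie_bracket_mult_left)
  have "lie_bracket R (u [^] i) r \<otimes> (v [^] j \<otimes> s) \<in> J (i + d + 2 * j)"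
  proof (rule weight_filtration_mult[OF weight_filtration_pow_bracket[OF r]])
    fix t assume t: "t \<in> carrier R"
    have "t \<otimes> (v [^] j \<otimes> s) = u [^] (0::nat) \<otimes> (v [^] j \<otimes> (t \<otimes> s))"
      using t gen v_pow_commute[OF t, of j] by (simp add: m_assoc[symmetric])
    then show "t \<otimes> (v [^] j \<otimes> s) \<in> J (2 * j)"
      using t gen weight_filtration.gen[of "2 * j" 0 j "t \<otimes> s" u v] by simp
  qed (use gen in simp)
  then have "lie_bracket R (u [^] i) r \<otimes> (v [^] j \<otimes> s) \<in> J (Suc w)"
    by (rule weight_filtration_mono) (use gen d in linarith)
  moreover have "u [^] i \<otimes> (v [^] j \<otimes> lie_bracket R s r) \<in> J (Suc w)"
    using weight_filtration_pow_mult[OF bracket[OF gen(2) r], of i j]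
    by (rule weight_filtration_mono) (use gen in linarith)
  ultimately show ?case unfolding eq by (simp add: weight_filtration.add)
qed

lemma lie_commutators_weight_filtration: "lie_commutators R (Suc w) \<subseteq> J w"
  by (intro lie_commutators_filtration weight_filtration_0 weight_filtration_bracket)

text \<open>Since ab = (1 + u) ba gives [b,a] = -u b a, each bracket with a draws a factor -u from
  b. Brackets falling on u^k have weight at least k + 2, because d >= 2, and join the error
  term.\<close>

lemma iterated_bracket_mod_weight_filtration:
  assumes a: "a \<in> carrier R" and b: "b \<in> carrier R" and ab: "a \<otimes> b = (\<one> \<oplus> u) \<otimes> b \<otimes> a" and d: "2 \<le> d"
  shows "\<exists>j \<in> J (Suc k). foldl (lie_bracket R) b (replicate k a)
           = (\<ominus> \<one>) [^] k \<otimes> (u [^] k \<otimes> (b \<otimes> a [^] k)) \<oplus> j"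
proof (induction k)
  case 0
  show ?case using b weight_filtration.zero by (intro bexI[of _ \<zero>]) auto
next
  case (Suc k)
  let ?e = "(\<ominus> \<one>) [^] k" and ?y = "b \<otimes> a [^] k"
  have y: "?y \<in> carrier R" and e: "?e \<in> carrier R" using a b by auto
  obtain j where j: "j \<in> J (Suc k)"
    "foldl (lie_bracket R) b (replicate k a) = ?e \<otimes> (u [^] k \<otimes> ?y) \<oplus> j"
    using Suc by blast
  have jc: "j \<in> carrier R" using j weight_filtration_closed by blast
  have ec: "?e \<otimes> r = r \<otimes> ?e" if "r \<in> carrier R" for r
    using that
  proof (induction k)
    case (Suc k)
    then show ?case by (simp add: l_minus r_minus)
  qed simp
  have "foldl (lie_bracket R) b (replicate (Suc k) a)
      = lie_bracket R (foldl (lie_bracket R) b (replicate k a)) a"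
    using replicate_append_same[of k a] foldl_append[of "lie_bracket R" b "replicate k a" "[a]"] by simp
  also have "\<dots> = lie_bracket R (?e \<otimes> (u [^] k \<otimes> ?y)) a \<oplus> lie_bracket R j a"
    using j a jc y e by (simp add: lie_bracket_add_left)
  also have "lie_bracket R (?e \<otimes> (u [^] k \<otimes> ?y)) a = ?e \<otimes> lie_bracket R (u [^] k \<otimes> ?y) a"
    using a y e ec[OF a] by (simp add: lie_bracket_mult_left) (simp add: lie_bracket_def a_minus_def r_neg)
  also have "lie_bracket R (u [^] k \<otimes> ?y) a
      = u [^] k \<otimes> lie_bracket R ?y a \<oplus> lie_bracket R (u [^] k) a \<otimes> ?y"
    using a y by (simp add: lie_bracket_mult_left)
  \<comment> \<open>Only b is affected, since a^k commutes with a.\<close>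
  also have "lie_bracket R ?y a = \<ominus> (u \<otimes> (b \<otimes> a [^] Suc k))"
  proof -
    have "lie_bracket R (a [^] k) a = \<zero>"
      using a nat_pow_Suc2[OF a, of k] by (simp add: lie_bracket_def)
    then have "lie_bracket R ?y a = lie_bracket R b a \<otimes> a [^] k"
      using a b by (simp add: lie_bracket_mult_left)
    also have "lie_bracket R b a = \<ominus> (u \<otimes> (b \<otimes> a))"
      unfolding lie_bracket_def ab using a b u by algebra
    finally show ?thesis using a b nat_pow_Suc2[OF a, of k] by (simp add: l_minus m_assoc)
  qed
  also have "u [^] k \<otimes> \<ominus> (u \<otimes> (b \<otimes> a [^] Suc k)) = \<ominus> (u [^] Suc k \<otimes> (b \<otimes> a [^] Suc k))"
    using a b by (simp add: r_minus m_assoc)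
  also have "?e \<otimes> (\<ominus> (u [^] Suc k \<otimes> (b \<otimes> a [^] Suc k)) \<oplus> lie_bracket R (u [^] k) a \<otimes> ?y) \<oplus> lie_bracket R j a
     = (\<ominus> \<one>) [^] Suc k \<otimes> (u [^] Suc k \<otimes> (b \<otimes> a [^] Suc k))
        \<oplus> (?e \<otimes> (lie_bracket R (u [^] k) a \<otimes> ?y) \<oplus> lie_bracket R j a)"
    using a b e jc y u by (simp add: r_distr a_assoc l_minus r_minus)
  finally have eq: "foldl (lie_bracket R) b (replicate (Suc k) a) = \<dots>" .
  have "lie_bracket R (u [^] k) a \<otimes> ?y \<otimes> ?e \<in> J (k + d)"
    using weight_filtration_pow_bracket[OF a, of k] y e by (intro weight_filtration_mult_right)
  then have "?e \<otimes> (lie_bracket R (u [^] k) a \<otimes> ?y) \<in> J (Suc (Suc k))"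
    using ec a y d by (auto intro: weight_filtration_mono)
  moreover have "lie_bracket R j a \<in> J (Suc (Suc k))"
    using j a by (intro weight_filtration_bracket)
  ultimately show ?case unfolding eq by (blast intro: weight_filtration.add)
qed

end

text \<open>A monomial u^i v^j survives only for i < q and j < e, so its weight is at most q + 2 e -
  3; the condition on w exceeds this, written without subtraction.\<close>

lemma weight_filtration_eq_zero:
  fixes q e :: nat
  assumes uq: "u [^] q = \<zero>" and ve: "v [^] e = \<zero>" and w: "q + 2 * e \<le> w + 2"
  shows "J w = {\<zero>}"
proof -
  have "x = \<zero>" if "x \<in> J w" for x
    using that
  proof (induction rule: weight_filtration.induct)
    case (gen i j r)
    have pow0: "y [^] n = \<zero>" if "y \<in> carrier R" "y [^] m = \<zero>" "m \<le> n" for y and m n :: nat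
    proof -
      have "y [^] m \<otimes> y [^] (n - m) = y [^] n" using that(1,3) by (simp add: nat_pow_mult)
      then show ?thesis using that l_null[OF nat_pow_closed[of y "n - m"]] by simp
    qed
    consider "q \<le> i" | "e \<le> j" | "i < q" "j < e" by linarith
    then show ?case
    proof cases
      case 1
      then show ?thesis using gen pow0[OF u uq] by simp
    next
      case 2
      then show ?thesis using gen pow0[OF v ve] by simp
    next
      case 3
      then have "i + 2 * j + 2 < q + 2 * e" by linarith
      then show ?thesis using gen w by linarith
    qed
  qed auto
  then show ?thesis using weight_filtration.zero by blast
qed

end

section \<open>Powers of x - 1 in characteristic 3\<close>

lemma minus_one_cubed:
  assumes "\<one> \<oplus> \<one> \<oplus> \<one> = \<zero>" and x: "x \<in> carrier R"
  shows "(x \<ominus> \<one>) [^] (3::nat) = x [^] (3::nat) \<ominus> \<one>"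
proof -
  have three: "y \<oplus> (y \<oplus> y) = \<zero>" if "y \<in> carrier R" for y
  proof -
    have "y \<oplus> (y \<oplus> y) = (\<one> \<oplus> \<one> \<oplus> \<one>) \<otimes> y" using that by algebra
    then show ?thesis using that assms(1) by simp
  qed
  have "(x \<ominus> \<one>) [^] (3::nat) = (x \<ominus> \<one>) \<otimes> (x \<ominus> \<one>) \<otimes> (x \<ominus> \<one>)"
    using x by (simp add: numeral_3_eq_3)
  \<comment> \<open>Regrouped so that the two middle binomial terms appear as threefold sums, which
    \<open>three\<close> removes.\<close>
  also have "\<dots> = (x \<otimes> x \<otimes> x \<ominus> \<one>) \<ominus> (x \<otimes> x \<oplus> (x \<otimes> x \<oplus> x \<otimes> x)) \<oplus> (x \<oplus> (x \<oplus> x))"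
    using x by (simp add: ring_simprules)
  also have "\<dots> = x \<otimes> x \<otimes> x \<ominus> \<one>"
    using x three by (simp add: a_minus_def)
  finally show ?thesis using x by (simp add: numeral_3_eq_3)
qed

lemma minus_one_pow_3_pow:
  assumes "\<one> \<oplus> \<one> \<oplus> \<one> = \<zero>" and x: "x \<in> carrier R"
  shows "(x \<ominus> \<one>) [^] (3 ^ k :: nat) = x [^] (3 ^ k :: nat) \<ominus> \<one>"
proof (induction k)
  case (Suc k)
  have "(x \<ominus> \<one>) [^] (3 ^ Suc k :: nat) = ((x \<ominus> \<one>) [^] (3 ^ k :: nat)) [^] (3::nat)"
    using x by (simp add: nat_pow_pow mult.commute)
  also have "\<dots> = (x [^] (3 ^ k :: nat)) [^] (3::nat) \<ominus> \<one>"
    using Suc x minus_one_cubed[OF assms(1)] by simp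
  finally show ?case using x by (simp add: nat_pow_pow mult.commute)
qed (use x in simp)

end

section \<open>The group algebra as a ring\<close>

text \<open>Taking c = 1 embeds the group, taking g to be the identity embeds the field.\<close>

definition monomial :: "('k, 'c) ring_scheme \<Rightarrow> ('g, 'd) monoid_scheme \<Rightarrow> 'k \<Rightarrow> 'g \<Rightarrow> 'g \<Rightarrow> 'k" where
  "monomial K G c g = (\<lambda>x\<in>carrier G. if x = g then c else \<zero>\<^bsub>K\<^esub>)"

locale group_algebra_over_field = K: field K + G: group G
  for K :: "('k, 'c) ring_scheme" (structure) and G :: "('g, 'd) monoid_scheme" (structure)
begin

abbreviation "A \<equiv> group_algebra K G"
abbreviation "supp f \<equiv> {y \<in> carrier G. f y \<noteq> \<zero>\<^bsub>K\<^esub>}"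
abbreviation "mterm \<equiv> monomial K G"
abbreviation "elt \<equiv> monomial K G \<one>\<^bsub>K\<^esub>"

lemma group_algebra_carrier:
  "f \<in> carrier A \<longleftrightarrow> f \<in> carrier G \<rightarrow>\<^sub>E carrier K \<and> finite (supp f)"
  by (auto simp: group_algebra_def)

lemma group_algebra_carrierD:
  assumes "f \<in> carrier A"
  shows "f \<in> extensional (carrier G)" "finite (supp f)"
    and "x \<in> carrier G \<Longrightarrow> f x \<in> carrier K"
  using assms by (auto simp: group_algebra_carrier PiE_def)

lemma group_algebra_eqI:
  "\<lbrakk>f \<in> carrier A; h \<in> carrier A; \<And>x. x \<in> carrier G \<Longrightarrow> f x = h x\<rbrakk> \<Longrightarrow> f = h"
  by (rule extensionalityI) (auto dest: group_algebra_carrierD)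

lemma add_eq: "x \<in> carrier G \<Longrightarrow> (f \<oplus>\<^bsub>A\<^esub> h) x = f x \<oplus>\<^bsub>K\<^esub> h x"
  by (simp add: group_algebra_def)

lemma zero_eq: "x \<in> carrier G \<Longrightarrow> \<zero>\<^bsub>A\<^esub> x = \<zero>\<^bsub>K\<^esub>"
  by (simp add: group_algebra_def)

lemma monomial_eq: "x \<in> carrier G \<Longrightarrow> mterm c g x = (if x = g then c else \<zero>\<^bsub>K\<^esub>)"
  by (simp add: monomial_def)

lemma one_eq: "\<one>\<^bsub>A\<^esub> = elt \<one>\<^bsub>G\<^esub>"
  by (simp add: group_algebra_def monomial_def)

section \<open>Sums and convolution products of finitely supported functions\<close>

lemma add_closed:
  assumes "f \<in> carrier A" "h \<in> carrier A"
  shows "f \<oplus>\<^bsub>A\<^esub> h \<in> carrier A"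
proof -
  have "supp (f \<oplus>\<^bsub>A\<^esub> h) \<subseteq> supp f \<union> supp h"
    by (auto simp: add_eq)
  then have "finite (supp (f \<oplus>\<^bsub>A\<^esub> h))"
    by (rule finite_subset) (use assms group_algebra_carrierD(2) in auto)
  then show ?thesis
    unfolding group_algebra_carrier
    using assms group_algebra_carrierD(3) by (auto simp: group_algebra_def)
qed

lemma zero_closed: "\<zero>\<^bsub>A\<^esub> \<in> carrier A"
  by (simp add: group_algebra_def)

lemma monomial_closed [simp]: "c \<in> carrier K \<Longrightarrow> mterm c g \<in> carrier A"
  unfolding group_algebra_carrier
  by (auto simp: monomial_def intro: finite_subset[of _ "{g}"])

text \<open>The defining sum runs over the support of f and so changes its range with f; a common
  finite superset makes sums for different f comparable, as distributivity requires.\<close>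

lemma mult_eq:
  assumes f: "f \<in> carrier A" and h: "h \<in> carrier A" and x: "x \<in> carrier G"
    and S: "finite S" "supp f \<subseteq> S" "S \<subseteq> carrier G"
  shows "(f \<otimes>\<^bsub>A\<^esub> h) x = (\<Oplus>\<^bsub>K\<^esub> y \<in> S. f y \<otimes>\<^bsub>K\<^esub> h (inv\<^bsub>G\<^esub> y \<otimes>\<^bsub>G\<^esub> x))"
proof -
  have "(f \<otimes>\<^bsub>A\<^esub> h) x = (\<Oplus>\<^bsub>K\<^esub> y \<in> supp f. f y \<otimes>\<^bsub>K\<^esub> h (inv\<^bsub>G\<^esub> y \<otimes>\<^bsub>G\<^esub> x))"
    using x by (simp add: group_algebra_def)
  also have "\<dots> = (\<Oplus>\<^bsub>K\<^esub> y \<in> S. f y \<otimes>\<^bsub>K\<^esub> h (inv\<^bsub>G\<^esub> y \<otimes>\<^bsub>G\<^esub> x))"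
  proof (rule K.add.finprod_mono_neutral_cong_left)
    show "f i \<otimes>\<^bsub>K\<^esub> h (inv\<^bsub>G\<^esub> i \<otimes>\<^bsub>G\<^esub> x) = \<zero>\<^bsub>K\<^esub>" if "i \<in> S - supp f" for i
      using that S x group_algebra_carrierD(3)[OF h] by auto
    show "(\<lambda>y. f y \<otimes>\<^bsub>K\<^esub> h (inv\<^bsub>G\<^esub> y \<otimes>\<^bsub>G\<^esub> x)) \<in> S \<rightarrow> carrier K"
      using S x group_algebra_carrierD(3)[OF h] group_algebra_carrierD(3)[OF f] by auto
  qed (use S in auto)
  finally show ?thesis .
qed

lemma mult_closed:
  assumes f: "f \<in> carrier A" and h: "h \<in> carrier A"
  shows "f \<otimes>\<^bsub>A\<^esub> h \<in> carrier A"
proof -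
  note fc = group_algebra_carrierD[OF f] and hc = group_algebra_carrierD[OF h]
  have eq: "(f \<otimes>\<^bsub>A\<^esub> h) x = (\<Oplus>\<^bsub>K\<^esub> y \<in> supp f. f y \<otimes>\<^bsub>K\<^esub> h (inv\<^bsub>G\<^esub> y \<otimes>\<^bsub>G\<^esub> x))"
    if "x \<in> carrier G" for x
    using that by (simp add: group_algebra_def)
  have "supp (f \<otimes>\<^bsub>A\<^esub> h) \<subseteq> (\<lambda>(y, z). y \<otimes>\<^bsub>G\<^esub> z) ` (supp f \<times> supp h)"
  proof
    fix x assume x: "x \<in> supp (f \<otimes>\<^bsub>A\<^esub> h)"
    have "\<exists>y \<in> supp f. f y \<otimes>\<^bsub>K\<^esub> h (inv\<^bsub>G\<^esub> y \<otimes>\<^bsub>G\<^esub> x) \<noteq> \<zero>\<^bsub>K\<^esub>"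
    proof (rule ccontr)
      assume "\<not> ?thesis"
      then have "(f \<otimes>\<^bsub>A\<^esub> h) x = \<zero>\<^bsub>K\<^esub>"
        using x eq by (auto intro!: K.add.finprod_one_eqI)
      then show False using x by simp
    qed
    then obtain y where y: "y \<in> supp f" "f y \<otimes>\<^bsub>K\<^esub> h (inv\<^bsub>G\<^esub> y \<otimes>\<^bsub>G\<^esub> x) \<noteq> \<zero>\<^bsub>K\<^esub>" by blast
    then have "inv\<^bsub>G\<^esub> y \<otimes>\<^bsub>G\<^esub> x \<in> supp h" using x fc by auto
    moreover have "x = y \<otimes>\<^bsub>G\<^esub> (inv\<^bsub>G\<^esub> y \<otimes>\<^bsub>G\<^esub> x)"
      using x y by (simp add: G.m_assoc[symmetric])
    ultimately show "x \<in> (\<lambda>(y, z). y \<otimes>\<^bsub>G\<^esub> z) ` (supp f \<times> supp h)" using y by force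
  qed
  then have "finite (supp (f \<otimes>\<^bsub>A\<^esub> h))"
    by (rule finite_subset) (use fc hc in auto)
  moreover have "f \<otimes>\<^bsub>A\<^esub> h \<in> extensional (carrier G)"
    by (simp add: group_algebra_def)
  moreover have "(f \<otimes>\<^bsub>A\<^esub> h) x \<in> carrier K" if "x \<in> carrier G" for x
    unfolding eq[OF that] using that fc hc by (auto intro!: K.finsum_closed)
  ultimately show ?thesis
    unfolding group_algebra_carrier by (auto simp: PiE_def)
qed

lemma monomial_mult:
  assumes "c \<in> carrier K" "g \<in> carrier G" "f \<in> carrier A" "x \<in> carrier G"
  shows "(mterm c g \<otimes>\<^bsub>A\<^esub> f) x = c \<otimes>\<^bsub>K\<^esub> f (inv\<^bsub>G\<^esub> g \<otimes>\<^bsub>G\<^esub> x)"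
  using assms group_algebra_carrierD(3)[OF assms(3)]
  by (subst mult_eq[of _ _ _ "{g}"]) (auto simp: monomial_eq split: if_splits)

lemma mult_monomial:
  assumes c: "c \<in> carrier K" and g: "g \<in> carrier G" and f: "f \<in> carrier A" and x: "x \<in> carrier G"
  shows "(f \<otimes>\<^bsub>A\<^esub> mterm c g) x = f (x \<otimes>\<^bsub>G\<^esub> inv\<^bsub>G\<^esub> g) \<otimes>\<^bsub>K\<^esub> c"
proof -
  \<comment> \<open>The only term that can be nonzero sits at y = x g^-1, inserted here because it
    may lie outside the support of f.\<close>
  let ?w = "x \<otimes>\<^bsub>G\<^esub> inv\<^bsub>G\<^esub> g" and ?S = "insert (x \<otimes>\<^bsub>G\<^esub> inv\<^bsub>G\<^esub> g) (supp f)"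
  note fc = group_algebra_carrierD[OF f]
  have "(f \<otimes>\<^bsub>A\<^esub> mterm c g) x = (\<Oplus>\<^bsub>K\<^esub> y \<in> ?S. f y \<otimes>\<^bsub>K\<^esub> mterm c g (inv\<^bsub>G\<^esub> y \<otimes>\<^bsub>G\<^esub> x))"
    using assms fc by (intro mult_eq) auto
  also have "\<dots> = (\<Oplus>\<^bsub>K\<^esub> y \<in> ?S. if ?w = y then f y \<otimes>\<^bsub>K\<^esub> c else \<zero>\<^bsub>K\<^esub>)"
  proof (rule K.finsum_cong')
    fix y assume y: "y \<in> ?S"
    then have yc: "y \<in> carrier G" using g x by auto
    have "inv\<^bsub>G\<^esub> y \<otimes>\<^bsub>G\<^esub> x = g \<longleftrightarrow> ?w = y"
      using yc g x by (metis G.inv_closed G.inv_solve_left' G.inv_solve_right')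
    then show "f y \<otimes>\<^bsub>K\<^esub> mterm c g (inv\<^bsub>G\<^esub> y \<otimes>\<^bsub>G\<^esub> x) = (if ?w = y then f y \<otimes>\<^bsub>K\<^esub> c else \<zero>\<^bsub>K\<^esub>)"
      using yc x c fc by (auto simp: monomial_eq)
  qed (use assms fc in auto)
  also have "\<dots> = f ?w \<otimes>\<^bsub>K\<^esub> c"
    using assms fc by (intro K.finsum_singleton) auto
  finally show ?thesis .
qed

lemma monomial_mult_monomial:
  assumes "c \<in> carrier K" "d \<in> carrier K" "g \<in> carrier G" "h \<in> carrier G"
  shows "mterm c g \<otimes>\<^bsub>A\<^esub> mterm d h = mterm (c \<otimes>\<^bsub>K\<^esub> d) (g \<otimes>\<^bsub>G\<^esub> h)"
proof (rule group_algebra_eqI)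
  fix x assume x: "x \<in> carrier G"
  have "inv\<^bsub>G\<^esub> g \<otimes>\<^bsub>G\<^esub> x = h \<longleftrightarrow> x = g \<otimes>\<^bsub>G\<^esub> h"
    using assms x by (metis G.inv_solve_left')
  then show "(mterm c g \<otimes>\<^bsub>A\<^esub> mterm d h) x = mterm (c \<otimes>\<^bsub>K\<^esub> d) (g \<otimes>\<^bsub>G\<^esub> h) x"
    using assms x by (simp add: monomial_mult monomial_eq)
qed (use assms mult_closed in auto)

section \<open>Ring axioms\<close>

lemma group_algebra_abelian_group: "abelian_group A"
proof (rule abelian_groupI)
  fix f assume f: "f \<in> carrier A"
  let ?n = "\<lambda>x\<in>carrier G. \<ominus>\<^bsub>K\<^esub> f x"
  have "supp ?n = supp f"
    using f group_algebra_carrierD(3) by auto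
  then have "?n \<in> carrier A"
    unfolding group_algebra_carrier
    using f group_algebra_carrierD[OF f] by auto
  moreover from this f have "?n \<oplus>\<^bsub>A\<^esub> f = \<zero>\<^bsub>A\<^esub>"
    by (intro group_algebra_eqI add_closed zero_closed)
      (auto simp: add_eq zero_eq group_algebra_carrierD K.l_neg)
  ultimately show "\<exists>h\<in>carrier A. h \<oplus>\<^bsub>A\<^esub> f = \<zero>\<^bsub>A\<^esub>" by blast
qed (auto intro!: group_algebra_eqI add_closed zero_closed
  simp: add_eq zero_eq group_algebra_carrierD K.a_ac)

lemma group_algebra_l_distr:
  assumes "f \<in> carrier A" "g \<in> carrier A" "h \<in> carrier A"
  shows "(f \<oplus>\<^bsub>A\<^esub> g) \<otimes>\<^bsub>A\<^esub> h = f \<otimes>\<^bsub>A\<^esub> h \<oplus>\<^bsub>A\<^esub> g \<otimes>\<^bsub>A\<^esub> h"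
proof (rule group_algebra_eqI)
  fix x assume x: "x \<in> carrier G"
  let ?S = "supp f \<union> supp g"
  note c = group_algebra_carrierD[OF assms(1)] group_algebra_carrierD[OF assms(2)]
    group_algebra_carrierD[OF assms(3)]
  have "((f \<oplus>\<^bsub>A\<^esub> g) \<otimes>\<^bsub>A\<^esub> h) x = (\<Oplus>\<^bsub>K\<^esub> y \<in> ?S. (f \<oplus>\<^bsub>A\<^esub> g) y \<otimes>\<^bsub>K\<^esub> h (inv\<^bsub>G\<^esub> y \<otimes>\<^bsub>G\<^esub> x))"
    using assms x c add_closed by (intro mult_eq) (auto simp: add_eq)
  also have "\<dots> = (\<Oplus>\<^bsub>K\<^esub> y \<in> ?S. f y \<otimes>\<^bsub>K\<^esub> h (inv\<^bsub>G\<^esub> y \<otimes>\<^bsub>G\<^esub> x) \<oplus>\<^bsub>K\<^esub> g y \<otimes>\<^bsub>K\<^esub> h (inv\<^bsub>G\<^esub> y \<otimes>\<^bsub>G\<^esub> x))"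
    using x c by (intro K.finsum_cong') (auto simp: add_eq K.l_distr)
  also have "\<dots> = (\<Oplus>\<^bsub>K\<^esub> y \<in> ?S. f y \<otimes>\<^bsub>K\<^esub> h (inv\<^bsub>G\<^esub> y \<otimes>\<^bsub>G\<^esub> x))
      \<oplus>\<^bsub>K\<^esub> (\<Oplus>\<^bsub>K\<^esub> y \<in> ?S. g y \<otimes>\<^bsub>K\<^esub> h (inv\<^bsub>G\<^esub> y \<otimes>\<^bsub>G\<^esub> x))"
    using x c by (intro K.finsum_addf) auto
  also have "\<dots> = (f \<otimes>\<^bsub>A\<^esub> h) x \<oplus>\<^bsub>K\<^esub> (g \<otimes>\<^bsub>A\<^esub> h) x"
    using assms x c by (intro arg_cong2[of _ _ _ _ "add K"] mult_eq[symmetric]) auto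
  finally show "((f \<oplus>\<^bsub>A\<^esub> g) \<otimes>\<^bsub>A\<^esub> h) x = (f \<otimes>\<^bsub>A\<^esub> h \<oplus>\<^bsub>A\<^esub> g \<otimes>\<^bsub>A\<^esub> h) x"
    using x by (simp add: add_eq)
qed (use assms in \<open>auto intro!: add_closed mult_closed\<close>)

lemma group_algebra_r_distr:
  assumes "f \<in> carrier A" "g \<in> carrier A" "h \<in> carrier A"
  shows "h \<otimes>\<^bsub>A\<^esub> (f \<oplus>\<^bsub>A\<^esub> g) = h \<otimes>\<^bsub>A\<^esub> f \<oplus>\<^bsub>A\<^esub> h \<otimes>\<^bsub>A\<^esub> g"
proof (rule group_algebra_eqI)
  fix x assume x: "x \<in> carrier G"
  note c = group_algebra_carrierD[OF assms(1)] group_algebra_carrierD[OF assms(2)]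
    group_algebra_carrierD[OF assms(3)]
  have "(h \<otimes>\<^bsub>A\<^esub> (f \<oplus>\<^bsub>A\<^esub> g)) x = (\<Oplus>\<^bsub>K\<^esub> y \<in> supp h. h y \<otimes>\<^bsub>K\<^esub> (f \<oplus>\<^bsub>A\<^esub> g) (inv\<^bsub>G\<^esub> y \<otimes>\<^bsub>G\<^esub> x))"
    using assms x c add_closed by (intro mult_eq) auto
  also have "\<dots> = (\<Oplus>\<^bsub>K\<^esub> y \<in> supp h. h y \<otimes>\<^bsub>K\<^esub> f (inv\<^bsub>G\<^esub> y \<otimes>\<^bsub>G\<^esub> x) \<oplus>\<^bsub>K\<^esub> h y \<otimes>\<^bsub>K\<^esub> g (inv\<^bsub>G\<^esub> y \<otimes>\<^bsub>G\<^esub> x))"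
    using x c by (intro K.finsum_cong') (auto simp: add_eq K.r_distr)
  also have "\<dots> = (\<Oplus>\<^bsub>K\<^esub> y \<in> supp h. h y \<otimes>\<^bsub>K\<^esub> f (inv\<^bsub>G\<^esub> y \<otimes>\<^bsub>G\<^esub> x))
      \<oplus>\<^bsub>K\<^esub> (\<Oplus>\<^bsub>K\<^esub> y \<in> supp h. h y \<otimes>\<^bsub>K\<^esub> g (inv\<^bsub>G\<^esub> y \<otimes>\<^bsub>G\<^esub> x))"
    using x c by (intro K.finsum_addf) auto
  also have "\<dots> = (h \<otimes>\<^bsub>A\<^esub> f) x \<oplus>\<^bsub>K\<^esub> (h \<otimes>\<^bsub>A\<^esub> g) x"
    using assms x c by (intro arg_cong2[of _ _ _ _ "add K"] mult_eq[symmetric]) auto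
  finally show "(h \<otimes>\<^bsub>A\<^esub> (f \<oplus>\<^bsub>A\<^esub> g)) x = (h \<otimes>\<^bsub>A\<^esub> f \<oplus>\<^bsub>A\<^esub> h \<otimes>\<^bsub>A\<^esub> g) x"
    using x by (simp add: add_eq)
qed (use assms in \<open>auto intro!: add_closed mult_closed\<close>)

text \<open>One support point is stripped at a time. This reduces additive statements about the
  group algebra to scalar multiples of group elements.\<close>

lemma group_algebra_induct [consumes 1, case_names zero add monomial]:
  assumes f: "f \<in> carrier A"
    and zero: "P \<zero>\<^bsub>A\<^esub>"
    and add: "\<And>f h. \<lbrakk>f \<in> carrier A; h \<in> carrier A; P f; P h\<rbrakk> \<Longrightarrow> P (f \<oplus>\<^bsub>A\<^esub> h)"
    and mon: "\<And>c g. \<lbrakk>c \<in> carrier K; g \<in> carrier G\<rbrakk> \<Longrightarrow> P (mterm c g)"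
  shows "P f"
proof -
  have "P f" if "finite S" "f \<in> carrier A" "supp f \<subseteq> S" "S \<subseteq> carrier G" for S f
    using that
  proof (induction S arbitrary: f rule: finite_induct)
    case empty
    then have "f = \<zero>\<^bsub>A\<^esub>"
      by (intro group_algebra_eqI zero_closed) (auto simp: zero_eq)
    then show ?case using zero by simp
  next
    case (insert g S)
    note fc = group_algebra_carrierD[OF insert.prems(1)]
    let ?f = "f(g := \<zero>\<^bsub>K\<^esub>)"
    have sub: "supp ?f \<subseteq> S" using insert.prems by auto
    have c: "?f \<in> carrier A"
      unfolding group_algebra_carrier
      using fc insert.prems insert.hyps finite_subset[OF sub]
      by (auto simp: PiE_def extensional_def)
    have "f = ?f \<oplus>\<^bsub>A\<^esub> mterm (f g) g"
      using fc insert.prems c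
      by (intro group_algebra_eqI add_closed) (auto simp: add_eq monomial_eq)
    moreover have "P ?f" by (rule insert.IH[OF c sub]) (use insert.prems in simp)
    ultimately show ?case
      using add[OF c, of "mterm (f g) g"] mon[of "f g" g] fc insert.prems by auto
  qed
  from this[of "supp f" f] f show ?thesis using group_algebra_carrierD by auto
qed

text \<open>Both sides are additive in each factor, so three inductions lead to monomials, where
  associativity comes from K and G.\<close>

lemma group_algebra_m_assoc:
  assumes "f \<in> carrier A" "g \<in> carrier A" "h \<in> carrier A"
  shows "(f \<otimes>\<^bsub>A\<^esub> g) \<otimes>\<^bsub>A\<^esub> h = f \<otimes>\<^bsub>A\<^esub> (g \<otimes>\<^bsub>A\<^esub> h)"
proof -
  interpret A: abelian_group A by (rule group_algebra_abelian_group)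
  note [simp] = mult_closed and distr = group_algebra_l_distr group_algebra_r_distr
  \<comment> \<open>\<open>A\<close> is so far only an abelian group with distributive product, so
    annihilation by 0 is derived by cancellation.\<close>
  have null: "\<zero>\<^bsub>A\<^esub> \<otimes>\<^bsub>A\<^esub> x = \<zero>\<^bsub>A\<^esub>" "x \<otimes>\<^bsub>A\<^esub> \<zero>\<^bsub>A\<^esub> = \<zero>\<^bsub>A\<^esub>" if x: "x \<in> carrier A" for x
  proof -
    have "\<zero>\<^bsub>A\<^esub> \<otimes>\<^bsub>A\<^esub> x \<oplus>\<^bsub>A\<^esub> \<zero>\<^bsub>A\<^esub> \<otimes>\<^bsub>A\<^esub> x = \<zero>\<^bsub>A\<^esub> \<otimes>\<^bsub>A\<^esub> x"
      using x by (simp add: group_algebra_l_distr[symmetric])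
    then show "\<zero>\<^bsub>A\<^esub> \<otimes>\<^bsub>A\<^esub> x = \<zero>\<^bsub>A\<^esub>" using x by (metis A.add.l_cancel_one' A.zero_closed mult_closed)
    have "x \<otimes>\<^bsub>A\<^esub> \<zero>\<^bsub>A\<^esub> \<oplus>\<^bsub>A\<^esub> x \<otimes>\<^bsub>A\<^esub> \<zero>\<^bsub>A\<^esub> = x \<otimes>\<^bsub>A\<^esub> \<zero>\<^bsub>A\<^esub>"
      using x by (simp add: group_algebra_r_distr[symmetric])
    then show "x \<otimes>\<^bsub>A\<^esub> \<zero>\<^bsub>A\<^esub> = \<zero>\<^bsub>A\<^esub>" using x by (metis A.add.l_cancel_one' A.zero_closed mult_closed)
  qed
  show ?thesis
    using assms(1)
  proof (induction rule: group_algebra_induct)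
    case f: (monomial c1 x1)
    show ?case using assms(2)
    proof (induction rule: group_algebra_induct)
      case g: (monomial c2 x2)
      show ?case using assms(3)
      proof (induction rule: group_algebra_induct)
        case (monomial c3 x3)
        then show ?case using f g by (simp add: monomial_mult_monomial K.m_assoc G.m_assoc)
      qed (use f g in \<open>simp_all add: null distr\<close>)
    qed (use f assms in \<open>simp_all add: null distr\<close>)
  qed (use assms in \<open>simp_all add: null distr\<close>)
qed

lemma ring_group_algebra: "ring A"
proof (rule ringI)
  show "monoid A"
  proof (rule monoidI)
    fix f assume f: "f \<in> carrier A"
    note fc = group_algebra_carrierD[OF f]
    show "\<one>\<^bsub>A\<^esub> \<otimes>\<^bsub>A\<^esub> f = f"
      using f fc unfolding one_eq
      by (intro group_algebra_eqI mult_closed) (auto simp: monomial_mult)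
    show "f \<otimes>\<^bsub>A\<^esub> \<one>\<^bsub>A\<^esub> = f"
      using f fc unfolding one_eq
      by (intro group_algebra_eqI mult_closed) (auto simp: mult_monomial)
  qed (auto intro: mult_closed group_algebra_m_assoc simp: one_eq)
qed (auto intro: group_algebra_abelian_group group_algebra_l_distr group_algebra_r_distr)

sublocale A: ring A by (rule ring_group_algebra)

end

section \<open>Relative augmentation ideals\<close>

lemma (in ring_hom_ring) hom_minus:
  "\<lbrakk>x \<in> carrier R; y \<in> carrier R\<rbrakk> \<Longrightarrow> h (x \<ominus> y) = h x \<ominus>\<^bsub>S\<^esub> h y"
  by (simp add: a_minus_def)

lemma (in ring_hom_ring) hom_lie_bracket:
  "\<lbrakk>x \<in> carrier R; y \<in> carrier R\<rbrakk> \<Longrightarrow> h (lie_bracket R x y) = lie_bracket S (h x) (h y)"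
  by (simp add: lie_bracket_def hom_minus)

lemma (in ring_hom_ring) hom_foldl_lie_bracket:
  "\<lbrakk>x \<in> carrier R; set xs \<subseteq> carrier R\<rbrakk> \<Longrightarrow>
    h (foldl (lie_bracket R) x xs) = foldl (lie_bracket S) (h x) (map h xs)"
  by (induction xs arbitrary: x) (auto simp: hom_lie_bracket)

text \<open>Surjectivity lets every entry of a commutator in S be lifted to R.\<close>

lemma (in ring_hom_ring) lie_commutators_image:
  assumes "h ` carrier R = carrier S"
  shows "lie_commutators S m = h ` lie_commutators R m"
proof
  show "h ` lie_commutators R m \<subseteq> lie_commutators S m"
    unfolding lie_commutators_def
  proof (clarify, intro exI conjI)
    fix x xs assume "x \<in> carrier R" "set xs \<subseteq> carrier R"
    then show "h (foldl (lie_bracket R) x xs) = foldl (lie_bracket S) (h x) (map h xs)"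
      "h x \<in> carrier S" "set (map h xs) \<subseteq> carrier S"
      by (auto simp: hom_foldl_lie_bracket)
  qed simp
  show "lie_commutators S m \<subseteq> h ` lie_commutators R m"
  proof
    fix c assume "c \<in> lie_commutators S m"
    then obtain y ys where y: "y \<in> carrier S" "set ys \<subseteq> carrier S" "Suc (length ys) = m"
      "c = foldl (lie_bracket S) y ys"
      unfolding lie_commutators_def by auto
    obtain x where x: "x \<in> carrier R" "y = h x" using y assms by blast
    obtain xs where xs: "set xs \<subseteq> carrier R" "ys = map h xs"
    proof
      show "set (map (inv_into (carrier R) h) ys) \<subseteq> carrier R"
        using y(2) unfolding assms[symmetric] by (auto intro: inv_into_into)
      show "ys = map h (map (inv_into (carrier R) h) ys)"
        using y(2) unfolding assms[symmetric] by (induction ys) (auto simp: f_inv_into_f)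
    qed
    show "c \<in> h ` lie_commutators R m"
      using y x xs hom_foldl_lie_bracket[OF x(1) xs(1)]
      unfolding lie_commutators_def by (auto intro!: image_eqI[of _ h "foldl (lie_bracket R) x xs"])
  qed
qed

section \<open>Divisibility by x - 1 and the weights of group products\<close>

context ring
begin

text \<open>The cofactor is the geometric sum 1 + y + ... + y^(i-1).\<close>

lemma pow_minus_one_factor:
  assumes y: "y \<in> carrier R"
  shows "\<exists>s \<in> carrier R. y [^] (i::nat) \<ominus> \<one> = (y \<ominus> \<one>) \<otimes> s"
proof (induction i)
  case 0
  show ?case using y by (intro bexI[of _ \<zero>]) (auto simp: a_minus_def r_neg)
next
  case (Suc i)
  then obtain s where s: "s \<in> carrier R" "y [^] i \<ominus> \<one> = (y \<ominus> \<one>) \<otimes> s" by blast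
  have "y [^] Suc i \<ominus> \<one> = (y [^] i \<ominus> \<one>) \<otimes> y \<oplus> (y \<ominus> \<one>)"
    using y by (simp add: ring_simprules)
  also have "\<dots> = (y \<ominus> \<one>) \<otimes> (s \<otimes> y \<oplus> \<one>)"
    using y s by (simp add: r_distr m_assoc)
  finally show ?case using y s by blast
qed

text \<open>The two claims supply the two bracket hypotheses of the weight filtration. Exponents of
  x divisible by 3 improve the weight because x^3 - 1 = (x - 1)^3.\<close>

lemma weight_filtration_products:
  assumes x: "x \<in> carrier R" and z: "z \<in> carrier R"
    and central: "\<And>r. r \<in> carrier R \<Longrightarrow> lie_bracket R (z \<ominus> \<one>) r = \<zero>"
  shows "x [^] (i::nat) \<otimes> z [^] (j::nat) \<ominus> \<one> \<in> weight_filtration (x \<ominus> \<one>) (z \<ominus> \<one>) 1"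
    and "\<one> \<oplus> \<one> \<oplus> \<one> = \<zero> \<Longrightarrow>
      x [^] (3 * i) \<otimes> z [^] j \<ominus> \<one> \<in> weight_filtration (x \<ominus> \<one>) (z \<ominus> \<one>) 2"
proof -
  let ?u = "x \<ominus> \<one>" and ?v = "z \<ominus> \<one>"
  \<comment> \<open>Splits off the part in z, of weight 2 by itself, so that only W - 1 remains to
    be estimated.\<close>
  have eq: "W \<otimes> z [^] j \<ominus> \<one> = (W \<ominus> \<one>) \<otimes> z [^] j \<oplus> (z [^] j \<ominus> \<one>)" if "W \<in> carrier R" for W
    using that nat_pow_closed[OF z, of j] by (simp add: a_minus_def l_distr l_minus a_assoc r_neg1)
  obtain s where s: "s \<in> carrier R" "z [^] j \<ominus> \<one> = ?v \<otimes> s"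
    using pow_minus_one_factor[OF z] by blast
  have v2: "z [^] j \<ominus> \<one> \<in> weight_filtration ?u ?v 2"
    using weight_filtration.gen[of 2 0 1 s ?u ?v] s x z by simp
  obtain t where t: "t \<in> carrier R" "x [^] i \<ominus> \<one> = ?u \<otimes> t"
    using pow_minus_one_factor[OF x] by blast
  have "(x [^] i \<ominus> \<one>) \<otimes> z [^] j \<in> weight_filtration ?u ?v 1"
    using weight_filtration.gen[of 1 1 0 "t \<otimes> z [^] j" ?u ?v] t x z by (simp add: m_assoc)
  moreover have "z [^] j \<ominus> \<one> \<in> weight_filtration ?u ?v 1"
    using v2 weight_filtration_mono[of ?u ?v] x z central by auto
  ultimately show "x [^] i \<otimes> z [^] j \<ominus> \<one> \<in> weight_filtration ?u ?v 1"
    using eq[of "x [^] i"] x by (simp add: weight_filtration.add)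
  assume three: "\<one> \<oplus> \<one> \<oplus> \<one> = \<zero>"
  obtain r where r: "r \<in> carrier R" "(x [^] (3::nat)) [^] i \<ominus> \<one> = (x [^] (3::nat) \<ominus> \<one>) \<otimes> r"
    using pow_minus_one_factor[of "x [^] (3::nat)"] x by auto
  have "x [^] (3 * i) \<ominus> \<one> = ?u [^] (3::nat) \<otimes> r"
    using r x minus_one_cubed[OF three x] by (simp add: nat_pow_pow)
  then have "(x [^] (3 * i) \<ominus> \<one>) \<otimes> z [^] j \<in> weight_filtration ?u ?v 2"
    using weight_filtration.gen[of 2 3 0 "r \<otimes> z [^] j" ?u ?v] r x z by (simp add: m_assoc)
  then show "x [^] (3 * i) \<otimes> z [^] j \<ominus> \<one> \<in> weight_filtration ?u ?v 2"
    using eq[of "x [^] (3 * i)"] x v2 by (simp add: weight_filtration.add)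
qed

end

section \<open>Lie commutators modulo an ideal\<close>

lemma (in ideal) quot_eq_zero_iff: "r \<in> carrier R \<Longrightarrow> I +> r = \<zero>\<^bsub>R Quot I\<^esub> \<longleftrightarrow> r \<in> I"
  using a_rcos_zero[OF ideal_axioms] rcos_const_imp_mem by (auto simp: FactRing_def)

lemma (in ideal) quot_surj: "(+>) I ` carrier R = carrier (R Quot I)"
  by (auto simp: FactRing_def A_RCOSETS_def' image_iff)

lemma (in ideal) quot_carrierE:
  assumes "s \<in> carrier (R Quot I)"
  obtains r where "r \<in> carrier R" "s = I +> r"
  using assms unfolding quot_surj[symmetric] by blast

lemma (in ideal) lie_commutators_quot:
  "lie_commutators (R Quot I) m = (+>) I ` lie_commutators R m"
  by (rule ring_hom_ring.lie_commutators_image[OF rcos_ring_hom_ring quot_surj])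

text \<open>Containment becomes vanishing in the quotient, where elements central only modulo the
  ideal are truly central.\<close>

lemma (in ideal) lie_commutators_subset_iff:
  "lie_commutators R m \<subseteq> I \<longleftrightarrow> lie_commutators (R Quot I) m \<subseteq> {\<zero>\<^bsub>R Quot I\<^esub>}"
  unfolding lie_commutators_quot
  using lie_commutators_closed[of m] quot_eq_zero_iff by blast

context group_algebra_over_field
begin

lemma elt_closed [simp]: "elt g \<in> carrier A"
  by simp

lemma elt_mult: "\<lbrakk>g \<in> carrier G; h \<in> carrier G\<rbrakk> \<Longrightarrow> elt g \<otimes>\<^bsub>A\<^esub> elt h = elt (g \<otimes>\<^bsub>G\<^esub> h)"
  by (simp add: monomial_mult_monomial)

lemma elt_pow: "g \<in> carrier G \<Longrightarrow> elt g [^]\<^bsub>A\<^esub> (n::nat) = elt (g [^]\<^bsub>G\<^esub> n)"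
  by (induction n) (auto simp: one_eq elt_mult)

lemma mterm_eq: "\<lbrakk>c \<in> carrier K; g \<in> carrier G\<rbrakk> \<Longrightarrow> mterm c g = elt g \<otimes>\<^bsub>A\<^esub> mterm c \<one>\<^bsub>G\<^esub>"
  by (simp add: monomial_mult_monomial)

lemma scalar_central:
  assumes "c \<in> carrier K" "f \<in> carrier A"
  shows "lie_bracket A (mterm c \<one>\<^bsub>G\<^esub>) f = \<zero>\<^bsub>A\<^esub>"
  using assms(2)
proof (induction rule: group_algebra_induct)
  case zero
  then show ?case using assms by (simp add: lie_bracket_def A.r_neg a_minus_def)
next
  case (add f h)
  then show ?case using assms by (simp add: A.lie_bracket_add_right)
next
  case (monomial d g)
  then show ?case
    using assms by (simp add: lie_bracket_def monomial_mult_monomial K.m_comm A.r_neg a_minus_def)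
qed

text \<open>Since \<open>x g = (x g x\<^sup>-\<^sup>1 g\<^sup>-\<^sup>1) g x\<close>, Lie commutators of group elements are governed by
  group commutators.\<close>

lemma lie_bracket_elt:
  assumes "x \<in> carrier G" "g \<in> carrier G"
  shows "lie_bracket A (elt x) (elt g) =
    (elt (x \<otimes>\<^bsub>G\<^esub> g \<otimes>\<^bsub>G\<^esub> inv\<^bsub>G\<^esub> x \<otimes>\<^bsub>G\<^esub> inv\<^bsub>G\<^esub> g) \<ominus>\<^bsub>A\<^esub> \<one>\<^bsub>A\<^esub>) \<otimes>\<^bsub>A\<^esub> elt (g \<otimes>\<^bsub>G\<^esub> x)"
proof -
  let ?c = "x \<otimes>\<^bsub>G\<^esub> g \<otimes>\<^bsub>G\<^esub> inv\<^bsub>G\<^esub> x \<otimes>\<^bsub>G\<^esub> inv\<^bsub>G\<^esub> g"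
  have "x \<otimes>\<^bsub>G\<^esub> g = ?c \<otimes>\<^bsub>G\<^esub> (g \<otimes>\<^bsub>G\<^esub> x)"
    using assms by (simp add: G.m_assoc) (simp add: G.m_assoc[symmetric])
  then have "elt (x \<otimes>\<^bsub>G\<^esub> g) = elt ?c \<otimes>\<^bsub>A\<^esub> elt (g \<otimes>\<^bsub>G\<^esub> x)"
    using assms by (simp add: elt_mult)
  then show ?thesis
    unfolding lie_bracket_def using assms
    by (simp add: elt_mult a_minus_def A.l_distr A.l_minus)
qed

section \<open>Lie brackets controlled by group commutators\<close>

context
  fixes T
  assumes T_closed: "T \<subseteq> carrier A" and T_zero: "\<zero>\<^bsub>A\<^esub> \<in> T"
    and T_add: "\<And>f h. \<lbrakk>f \<in> T; h \<in> T\<rbrakk> \<Longrightarrow> f \<oplus>\<^bsub>A\<^esub> h \<in> T"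
    and T_mult: "\<And>f h. \<lbrakk>f \<in> T; h \<in> carrier A\<rbrakk> \<Longrightarrow> f \<otimes>\<^bsub>A\<^esub> h \<in> T"
begin

text \<open>T is a right ideal, so that it may be a two-sided ideal, a step of a weight filtration
  or the preimage of one. This suffices because (x,g) - 1 stands on the left in the bracket of x and
  g.\<close>

lemma lie_bracket_elt_mem:
  assumes x: "x \<in> carrier G"
    and T: "\<And>g. g \<in> carrier G \<Longrightarrow> elt (x \<otimes>\<^bsub>G\<^esub> g \<otimes>\<^bsub>G\<^esub> inv\<^bsub>G\<^esub> x \<otimes>\<^bsub>G\<^esub> inv\<^bsub>G\<^esub> g) \<ominus>\<^bsub>A\<^esub> \<one>\<^bsub>A\<^esub> \<in> T"
    and r: "r \<in> carrier A"
  shows "lie_bracket A (elt x) r \<in> T"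
  using r
proof (induction rule: group_algebra_induct)
  case zero
  then show ?case using T_zero by (simp add: lie_bracket_def A.r_neg a_minus_def)
next
  case (add f h)
  then show ?case using T_add by (simp add: A.lie_bracket_add_right)
next
  case (monomial c g)
  let ?s = "mterm c \<one>\<^bsub>G\<^esub>"
  have sc: "elt y \<otimes>\<^bsub>A\<^esub> ?s = ?s \<otimes>\<^bsub>A\<^esub> elt y" if "y \<in> carrier G" for y
    using monomial that by (simp add: monomial_mult_monomial)
  have "lie_bracket A (elt x) (mterm c g) = lie_bracket A (elt x) (elt g) \<otimes>\<^bsub>A\<^esub> ?s"
    using monomial x sc[OF x]
    by (simp add: mterm_eq[of c g] lie_bracket_def a_minus_def A.l_distr A.l_minus A.m_assoc)
  also have "\<dots> \<in> T"
    unfolding lie_bracket_elt[OF x monomial(2)] using monomial T by (auto intro!: T_mult)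
  finally show ?case .
qed

text \<open>Coefficients are central scalars, so additivity in both arguments reduces everything to
  group elements.\<close>

lemma lie_bracket_mem:
  assumes T: "\<And>x g. \<lbrakk>x \<in> carrier G; g \<in> carrier G\<rbrakk> \<Longrightarrow>
      elt (x \<otimes>\<^bsub>G\<^esub> g \<otimes>\<^bsub>G\<^esub> inv\<^bsub>G\<^esub> x \<otimes>\<^bsub>G\<^esub> inv\<^bsub>G\<^esub> g) \<ominus>\<^bsub>A\<^esub> \<one>\<^bsub>A\<^esub> \<in> T"
    and r: "r \<in> carrier A" and s: "s \<in> carrier A"
  shows "lie_bracket A r s \<in> T"
  using r
proof (induction rule: group_algebra_induct)
  case zero
  then show ?case using T_zero s by simp
next
  case (add f h)
  then show ?case using T_add s by (simp add: A.lie_bracket_add_left)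
next
  case (monomial c x)
  have "lie_bracket A (mterm c x) s = lie_bracket A (elt x) s \<otimes>\<^bsub>A\<^esub> mterm c \<one>\<^bsub>G\<^esub>"
    using monomial s scalar_central[OF monomial(1) s]
    by (simp add: mterm_eq[of c x] A.lie_bracket_mult_left)
  also have "\<dots> \<in> T"
    using monomial s T by (intro T_mult lie_bracket_elt_mem) auto
  finally show ?case .
qed

end

text \<open>For normal N this is the kernel of KG -> K[G/N]; computing modulo it replaces the group
  algebra of the quotient group.\<close>

definition relative_augmentation_ideal :: "'g set \<Rightarrow> ('g \<Rightarrow> 'k) set" where
  "relative_augmentation_ideal N = genideal A ((\<lambda>a. elt a \<ominus>\<^bsub>A\<^esub> \<one>\<^bsub>A\<^esub>) ` N)"

abbreviation "Aug \<equiv> relative_augmentation_ideal"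

lemma ideal_Aug: "ideal (Aug N) A"
  unfolding relative_augmentation_ideal_def by (intro A.genideal_ideal) auto

lemma Aug_mem: "a \<in> N \<Longrightarrow> elt a \<ominus>\<^bsub>A\<^esub> \<one>\<^bsub>A\<^esub> \<in> Aug N"
  unfolding relative_augmentation_ideal_def
  by (rule subsetD[OF A.genideal_self imageI]) auto

lemma Aug_minimal:
  "\<lbrakk>ideal I A; \<And>a. a \<in> N \<Longrightarrow> elt a \<ominus>\<^bsub>A\<^esub> \<one>\<^bsub>A\<^esub> \<in> I\<rbrakk> \<Longrightarrow> Aug N \<subseteq> I"
  unfolding relative_augmentation_ideal_def by (intro A.genideal_minimal) auto

lemma Aug_one: "Aug {\<one>\<^bsub>G\<^esub>} = {\<zero>\<^bsub>A\<^esub>}"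
proof
  show "Aug {\<one>\<^bsub>G\<^esub>} \<subseteq> {\<zero>\<^bsub>A\<^esub>}"
    by (rule Aug_minimal) (auto simp: A.zeroideal one_eq[symmetric] a_minus_def A.r_neg)
  show "{\<zero>\<^bsub>A\<^esub>} \<subseteq> Aug {\<one>\<^bsub>G\<^esub>}"
    using ideal_Aug additive_subgroup.zero_closed ideal_def by blast
qed

lemma lie_commutators_two:
  assumes "c \<in> lie_commutators A 2"
  shows "\<exists>r \<in> carrier A. \<exists>s \<in> carrier A. c = lie_bracket A r s"
proof -
  obtain x xs where x: "x \<in> carrier A" "set xs \<subseteq> carrier A" "length xs = 1"
    "c = foldl (lie_bracket A) x xs"
    using assms unfolding lie_commutators_def by auto
  then obtain y where "xs = [y]" by (auto simp: length_Suc_conv)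
  then show ?thesis using x by auto
qed

text \<open>Starting point of the descent: the bracket of two group elements is a multiple of (x,g)
  - 1 with (x,g) in G'.\<close>

lemma lie_commutators_two_Aug_derived: "lie_commutators A 2 \<subseteq> Aug (derived G (carrier G))"
proof
  interpret I: ideal "Aug (derived G (carrier G))" A by (rule ideal_Aug)
  fix c assume "c \<in> lie_commutators A 2"
  then obtain r s where c: "r \<in> carrier A" "s \<in> carrier A" "c = lie_bracket A r s"
    using lie_commutators_two by blast
  show "c \<in> Aug (derived G (carrier G))"
    unfolding c(3)
  proof (rule lie_bracket_mem[OF _ _ _ _ _ c(1,2)])
    fix x g assume "x \<in> carrier G" "g \<in> carrier G"
    then show "elt (x \<otimes>\<^bsub>G\<^esub> g \<otimes>\<^bsub>G\<^esub> inv\<^bsub>G\<^esub> x \<otimes>\<^bsub>G\<^esub> inv\<^bsub>G\<^esub> g) \<ominus>\<^bsub>A\<^esub> \<one>\<^bsub>A\<^esub> \<in> Aug (derived G (carrier G))"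
      unfolding derived_def by (intro Aug_mem generate.incl) blast
  qed (auto intro: I.I_r_closed)
qed

end

section \<open>Upper bounds\<close>

context group_algebra_over_field
begin

lemma Aug_quot_elt:
  assumes "a \<in> N"
  shows "Aug N +>\<^bsub>A\<^esub> elt a = \<one>\<^bsub>A Quot Aug N\<^esub>"
proof -
  interpret I: ideal "Aug N" A by (rule ideal_Aug)
  interpret h: ring_hom_ring A "A Quot Aug N" "a_r_coset A (Aug N)" by (rule I.rcos_ring_hom_ring)
  show ?thesis
    using I.quot_eq_zero_iff[of "elt a \<ominus>\<^bsub>A\<^esub> \<one>\<^bsub>A\<^esub>"] Aug_mem[OF assms]
    by (simp add: h.hom_minus h.S.r_right_minus_eq)
qed

text \<open>The multiples of the image of v = z - 1 catch all of Aug B, because b = z^i a has the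
  image of z^i and z^i - 1 is a multiple of z - 1. So \<open>lie_commutators_central\<close> applies
  with e = 3.\<close>

lemma lie_commutators_central_step:
  assumes z: "z \<in> carrier G" and z3: "z [^]\<^bsub>G\<^esub> (3::nat) \<in> N"
    and central: "\<And>g. g \<in> carrier G \<Longrightarrow> z \<otimes>\<^bsub>G\<^esub> g \<otimes>\<^bsub>G\<^esub> inv\<^bsub>G\<^esub> z \<otimes>\<^bsub>G\<^esub> inv\<^bsub>G\<^esub> g \<in> N"
    and N: "N \<subseteq> carrier G"
    and B: "\<And>b. b \<in> B \<Longrightarrow> \<exists>i::nat. \<exists>a\<in>N. b = z [^]\<^bsub>G\<^esub> i \<otimes>\<^bsub>G\<^esub> a"
    and three: "\<one>\<^bsub>A\<^esub> \<oplus>\<^bsub>A\<^esub> \<one>\<^bsub>A\<^esub> \<oplus>\<^bsub>A\<^esub> \<one>\<^bsub>A\<^esub> = \<zero>\<^bsub>A\<^esub>"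
    and m: "0 < m" "lie_commutators A m \<subseteq> Aug B"
  shows "lie_commutators A (Suc (3 * (m - 1))) \<subseteq> Aug N"
proof -
  interpret I: ideal "Aug N" A by (rule ideal_Aug)
  let ?Q = "A Quot Aug N" and ?h = "a_r_coset A (Aug N)"
  interpret h: ring_hom_ring A ?Q ?h by (rule I.rcos_ring_hom_ring)
  let ?v = "elt z \<ominus>\<^bsub>A\<^esub> \<one>\<^bsub>A\<^esub>"
  have vbr: "lie_bracket A ?v r \<in> Aug N" if r: "r \<in> carrier A" for r
  proof -
    have "lie_bracket A ?v r = lie_bracket A (elt z) r"
      using r by (simp add: A.lie_bracket_minus_one_left)
    moreover have "lie_bracket A (elt z) r \<in> Aug N"
      by (rule lie_bracket_elt_mem[OF _ _ _ _ z _ r])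
        (use z central Aug_mem in \<open>auto intro: I.I_r_closed\<close>)
    ultimately show ?thesis by simp
  qed
  have vc: "?v \<in> carrier A" by (rule A.minus_closed) simp_all
  have hv: "?h ?v \<in> carrier ?Q" by (rule h.hom_closed[OF vc])
  have hvbr: "lie_bracket ?Q (?h ?v) s = \<zero>\<^bsub>?Q\<^esub>" if "s \<in> carrier ?Q" for s
  proof -
    obtain r where r: "r \<in> carrier A" "s = ?h r" by (rule I.quot_carrierE[OF \<open>s \<in> carrier ?Q\<close>])
    have "?h (lie_bracket A ?v r) = \<zero>\<^bsub>?Q\<^esub>"
      using I.quot_eq_zero_iff vbr A.lie_bracket_closed vc r(1) by blast
    then show ?thesis
      unfolding r(2) using h.hom_lie_bracket[OF vc r(1)] by argo
  qed
  \<comment> \<open>The preimage of the ideal of multiples of the central image of v; being an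
    ideal, it can be compared with \<open>Aug B\<close> on generators.\<close>
  let ?D = "{r \<in> carrier A. ?h r \<in> {?h ?v \<otimes>\<^bsub>?Q\<^esub> s | s. s \<in> carrier ?Q}}"
  have "ideal ?D A"
    by (rule h.ideal_vimage[OF h.S.central_multiples_ideal[OF hv hvbr]])
  then have AugB: "Aug B \<subseteq> ?D"
  proof (rule Aug_minimal)
    fix b assume "b \<in> B"
    then obtain i :: nat and a where b: "a \<in> N" "b = z [^]\<^bsub>G\<^esub> i \<otimes>\<^bsub>G\<^esub> a" using B by blast
    then have "elt b = elt z [^]\<^bsub>A\<^esub> i \<otimes>\<^bsub>A\<^esub> elt a"
      using z N by (auto simp: elt_pow elt_mult)
    then have "?h (elt b) = ?h (elt z) [^]\<^bsub>?Q\<^esub> i"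
      using b Aug_quot_elt by (simp add: h.hom_nat_pow)
    moreover obtain s where "s \<in> carrier ?Q"
      "?h (elt z) [^]\<^bsub>?Q\<^esub> i \<ominus>\<^bsub>?Q\<^esub> \<one>\<^bsub>?Q\<^esub> = (?h (elt z) \<ominus>\<^bsub>?Q\<^esub> \<one>\<^bsub>?Q\<^esub>) \<otimes>\<^bsub>?Q\<^esub> s"
      using h.S.pow_minus_one_factor[of "?h (elt z)" i] by auto
    ultimately show "elt b \<ominus>\<^bsub>A\<^esub> \<one>\<^bsub>A\<^esub> \<in> ?D"
      by (auto simp: h.hom_minus)
  qed
  have v3: "?h ?v [^]\<^bsub>?Q\<^esub> (3::nat) = \<zero>\<^bsub>?Q\<^esub>"
  proof -
    have "?v [^]\<^bsub>A\<^esub> (3::nat) = elt (z [^]\<^bsub>G\<^esub> (3::nat)) \<ominus>\<^bsub>A\<^esub> \<one>\<^bsub>A\<^esub>"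
      using A.minus_one_cubed[OF three, of "elt z"] z by (simp add: elt_pow)
    then have "?h (?v [^]\<^bsub>A\<^esub> (3::nat)) = \<zero>\<^bsub>?Q\<^esub>"
      using Aug_mem[OF z3] I.quot_eq_zero_iff by simp
    then show ?thesis by (simp add: h.hom_nat_pow)
  qed
  show ?thesis
    unfolding I.lie_commutators_subset_iff
  proof
    fix c assume c: "c \<in> lie_commutators ?Q (Suc (3 * (m - 1)))"
    have "\<exists>r \<in> carrier ?Q. c = ?h ?v [^]\<^bsub>?Q\<^esub> (3::nat) \<otimes>\<^bsub>?Q\<^esub> r"
    proof (rule h.S.lie_commutators_central[OF hv hvbr m(1) _ c])
      fix c assume "c \<in> lie_commutators ?Q m"
      then obtain d where "d \<in> lie_commutators A m" "c = ?h d"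
        unfolding I.lie_commutators_quot by blast
      then show "\<exists>r \<in> carrier ?Q. c = ?h ?v \<otimes>\<^bsub>?Q\<^esub> r"
        using m(2) AugB by blast
    qed
    then show "c \<in> {\<zero>\<^bsub>?Q\<^esub>}" using v3 by auto
  qed
qed

text \<open>The weight filtration is applied with d = 1: \<open>comm\<close> gives every bracket
  weight at least 1, and \<open>xcomm\<close> gives brackets with x - 1 weight at least 2.\<close>

lemma lie_commutators_noncyclic_step:
  assumes x: "x \<in> carrier G" and z: "z \<in> carrier G"
    and z3: "z [^]\<^bsub>G\<^esub> (3::nat) \<in> N" and xk: "x [^]\<^bsub>G\<^esub> (3 ^ k :: nat) \<in> N"
    and central: "\<And>g. g \<in> carrier G \<Longrightarrow> z \<otimes>\<^bsub>G\<^esub> g \<otimes>\<^bsub>G\<^esub> inv\<^bsub>G\<^esub> z \<otimes>\<^bsub>G\<^esub> inv\<^bsub>G\<^esub> g \<in> N"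
    and N: "N \<subseteq> carrier G"
    and comm: "\<And>g h. \<lbrakk>g \<in> carrier G; h \<in> carrier G\<rbrakk> \<Longrightarrow>
      \<exists>(i::nat) (j::nat). \<exists>a\<in>N. g \<otimes>\<^bsub>G\<^esub> h \<otimes>\<^bsub>G\<^esub> inv\<^bsub>G\<^esub> g \<otimes>\<^bsub>G\<^esub> inv\<^bsub>G\<^esub> h = x [^]\<^bsub>G\<^esub> i \<otimes>\<^bsub>G\<^esub> z [^]\<^bsub>G\<^esub> j \<otimes>\<^bsub>G\<^esub> a"
    and xcomm: "\<And>g. g \<in> carrier G \<Longrightarrow>
      \<exists>(i::nat) (j::nat). \<exists>a\<in>N. x \<otimes>\<^bsub>G\<^esub> g \<otimes>\<^bsub>G\<^esub> inv\<^bsub>G\<^esub> x \<otimes>\<^bsub>G\<^esub> inv\<^bsub>G\<^esub> g = x [^]\<^bsub>G\<^esub> (3 * i) \<otimes>\<^bsub>G\<^esub> z [^]\<^bsub>G\<^esub> j \<otimes>\<^bsub>G\<^esub> a"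
    and three: "\<one>\<^bsub>A\<^esub> \<oplus>\<^bsub>A\<^esub> \<one>\<^bsub>A\<^esub> \<oplus>\<^bsub>A\<^esub> \<one>\<^bsub>A\<^esub> = \<zero>\<^bsub>A\<^esub>"
  shows "lie_commutators A (3 ^ k + 5) \<subseteq> Aug N"
proof -
  interpret I: ideal "Aug N" A by (rule ideal_Aug)
  let ?Q = "A Quot Aug N" and ?h = "a_r_coset A (Aug N)"
  interpret h: ring_hom_ring A ?Q ?h by (rule I.rcos_ring_hom_ring)
  let ?x = "?h (elt x)" and ?z = "?h (elt z)"
  let ?u = "?x \<ominus>\<^bsub>?Q\<^esub> \<one>\<^bsub>?Q\<^esub>" and ?v = "?z \<ominus>\<^bsub>?Q\<^esub> \<one>\<^bsub>?Q\<^esub>"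
  let ?J = "h.S.weight_filtration ?u ?v"
  have uc: "?u \<in> carrier ?Q" and vc: "?v \<in> carrier ?Q" by auto
  have v_central: "lie_bracket ?Q ?v s = \<zero>\<^bsub>?Q\<^esub>" if s: "s \<in> carrier ?Q" for s
  proof -
    obtain r where r: "r \<in> carrier A" "s = ?h r" by (rule I.quot_carrierE[OF s])
    have "lie_bracket A (elt z) r \<in> Aug N"
      by (rule lie_bracket_elt_mem[OF _ _ _ _ z _ r(1)])
        (use z central Aug_mem in \<open>auto intro: I.I_r_closed\<close>)
    then have "?h (lie_bracket A (elt z) r) = \<zero>\<^bsub>?Q\<^esub>"
      using I.quot_eq_zero_iff r by simp
    then show ?thesis
      using r by (simp add: h.S.lie_bracket_minus_one_left h.hom_lie_bracket)
  qed
  note wf = h.S.weight_filtration_closed[OF uc vc v_central]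
    h.S.weight_filtration_mult_right[OF uc vc v_central]
  have threeQ: "\<one>\<^bsub>?Q\<^esub> \<oplus>\<^bsub>?Q\<^esub> \<one>\<^bsub>?Q\<^esub> \<oplus>\<^bsub>?Q\<^esub> \<one>\<^bsub>?Q\<^esub> = \<zero>\<^bsub>?Q\<^esub>"
    using arg_cong[OF three, of ?h] by simp
  \<comment> \<open>The preimage of a filtration step is a right ideal, as the reduction to group
    commutators demands.\<close>
  have T: "{r \<in> carrier A. ?h r \<in> ?J w} \<subseteq> carrier A" "\<zero>\<^bsub>A\<^esub> \<in> {r \<in> carrier A. ?h r \<in> ?J w}"
    "\<And>f f'. \<lbrakk>f \<in> {r \<in> carrier A. ?h r \<in> ?J w}; f' \<in> {r \<in> carrier A. ?h r \<in> ?J w}\<rbrakk>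
        \<Longrightarrow> f \<oplus>\<^bsub>A\<^esub> f' \<in> {r \<in> carrier A. ?h r \<in> ?J w}"
    "\<And>f f'. \<lbrakk>f \<in> {r \<in> carrier A. ?h r \<in> ?J w}; f' \<in> carrier A\<rbrakk>
        \<Longrightarrow> f \<otimes>\<^bsub>A\<^esub> f' \<in> {r \<in> carrier A. ?h r \<in> ?J w}" for w
    using wf by (auto intro: h.S.weight_filtration.zero h.S.weight_filtration.add)
  have h_prod: "?h (elt (x [^]\<^bsub>G\<^esub> i \<otimes>\<^bsub>G\<^esub> z [^]\<^bsub>G\<^esub> j \<otimes>\<^bsub>G\<^esub> a) \<ominus>\<^bsub>A\<^esub> \<one>\<^bsub>A\<^esub>)
      = ?x [^]\<^bsub>?Q\<^esub> i \<otimes>\<^bsub>?Q\<^esub> ?z [^]\<^bsub>?Q\<^esub> j \<ominus>\<^bsub>?Q\<^esub> \<one>\<^bsub>?Q\<^esub>" if a: "a \<in> N" for i j :: nat and a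
  proof -
    have "elt (x [^]\<^bsub>G\<^esub> i \<otimes>\<^bsub>G\<^esub> z [^]\<^bsub>G\<^esub> j \<otimes>\<^bsub>G\<^esub> a)
        = elt x [^]\<^bsub>A\<^esub> i \<otimes>\<^bsub>A\<^esub> elt z [^]\<^bsub>A\<^esub> j \<otimes>\<^bsub>A\<^esub> elt a"
      using x z a N by (auto simp: elt_pow elt_mult)
    then show ?thesis using a Aug_quot_elt by (simp add: h.hom_nat_pow h.hom_minus)
  qed
  have bracket: "lie_bracket ?Q r s \<in> ?J 1" if r: "r \<in> carrier ?Q" and s: "s \<in> carrier ?Q" for r s
  proof -
    obtain r' s' where rs: "r' \<in> carrier A" "r = ?h r'" "s' \<in> carrier A" "s = ?h s'"
      using I.quot_carrierE[OF r] I.quot_carrierE[OF s] by metis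
    have "lie_bracket A r' s' \<in> {r \<in> carrier A. ?h r \<in> ?J 1}"
    proof (rule lie_bracket_mem[OF T _ rs(1,3)])
      fix g g' assume g: "g \<in> carrier G" "g' \<in> carrier G"
      obtain i j :: nat and a where a: "a \<in> N"
        "g \<otimes>\<^bsub>G\<^esub> g' \<otimes>\<^bsub>G\<^esub> inv\<^bsub>G\<^esub> g \<otimes>\<^bsub>G\<^esub> inv\<^bsub>G\<^esub> g' = x [^]\<^bsub>G\<^esub> i \<otimes>\<^bsub>G\<^esub> z [^]\<^bsub>G\<^esub> j \<otimes>\<^bsub>G\<^esub> a"
        using comm[OF g] by (elim exE bexE) (rule that)
      show "elt (g \<otimes>\<^bsub>G\<^esub> g' \<otimes>\<^bsub>G\<^esub> inv\<^bsub>G\<^esub> g \<otimes>\<^bsub>G\<^esub> inv\<^bsub>G\<^esub> g') \<ominus>\<^bsub>A\<^esub> \<one>\<^bsub>A\<^esub> \<in> {r \<in> carrier A. ?h r \<in> ?J 1}"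
        unfolding a(2) using h_prod[OF a(1)] h.S.weight_filtration_products(1)[of ?x ?z] v_central
        by simp
    qed
    then show ?thesis using rs by (simp add: h.hom_lie_bracket)
  qed
  have u_bracket: "lie_bracket ?Q ?u r \<in> ?J (Suc 1)" if r: "r \<in> carrier ?Q" for r
  proof -
    obtain r' where r': "r' \<in> carrier A" "r = ?h r'"
      by (rule I.quot_carrierE[OF r])
    have "lie_bracket A (elt x) r' \<in> {r \<in> carrier A. ?h r \<in> ?J 2}"
    proof (rule lie_bracket_elt_mem[OF T x _ r'(1)])
      fix g assume g: "g \<in> carrier G"
      obtain i j :: nat and a where a: "a \<in> N"
        "x \<otimes>\<^bsub>G\<^esub> g \<otimes>\<^bsub>G\<^esub> inv\<^bsub>G\<^esub> x \<otimes>\<^bsub>G\<^esub> inv\<^bsub>G\<^esub> g = x [^]\<^bsub>G\<^esub> (3 * i) \<otimes>\<^bsub>G\<^esub> z [^]\<^bsub>G\<^esub> j \<otimes>\<^bsub>G\<^esub> a"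
        using xcomm[OF g] by (elim exE bexE) (rule that)
      show "elt (x \<otimes>\<^bsub>G\<^esub> g \<otimes>\<^bsub>G\<^esub> inv\<^bsub>G\<^esub> x \<otimes>\<^bsub>G\<^esub> inv\<^bsub>G\<^esub> g) \<ominus>\<^bsub>A\<^esub> \<one>\<^bsub>A\<^esub> \<in> {r \<in> carrier A. ?h r \<in> ?J 2}"
        unfolding a(2) using h_prod[OF a(1)] h.S.weight_filtration_products(2)[of ?x ?z] v_central threeQ
        by simp
    qed
    then show ?thesis using r' by (simp add: h.hom_lie_bracket h.S.lie_bracket_minus_one_left numeral_2_eq_2)
  qed
  have nilp: "(?h (elt y) \<ominus>\<^bsub>?Q\<^esub> \<one>\<^bsub>?Q\<^esub>) [^]\<^bsub>?Q\<^esub> (3 ^ l :: nat) = \<zero>\<^bsub>?Q\<^esub>"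
    if "y \<in> carrier G" "y [^]\<^bsub>G\<^esub> (3 ^ l :: nat) \<in> N" for y l
  proof -
    have "?h (elt y) [^]\<^bsub>?Q\<^esub> (3 ^ l :: nat) = \<one>\<^bsub>?Q\<^esub>"
      using Aug_quot_elt[OF that(2)] that(1) by (simp add: h.hom_nat_pow[symmetric] elt_pow)
    then show ?thesis
      using h.S.minus_one_pow_3_pow[OF threeQ, of "?h (elt y)" l] by (simp add: a_minus_def h.S.r_neg)
  qed
  \<comment> \<open>With q = 3^k and e = 3 the bound q + 2 e - 2 is 3^k + 4, and length exceeds
    weight by one.\<close>
  have "?J (3 ^ k + 4) = {\<zero>\<^bsub>?Q\<^esub>}"
    using nilp[OF x xk] nilp[OF z, of 1] z3
    by (intro h.S.weight_filtration_eq_zero[OF uc vc v_central, of "3 ^ k" 3]) auto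
  then have "lie_commutators ?Q (Suc (3 ^ k + 4)) \<subseteq> {\<zero>\<^bsub>?Q\<^esub>}"
    using h.S.lie_commutators_weight_filtration[OF uc vc v_central zero_less_one u_bracket bracket] by metis
  then show ?thesis
    unfolding I.lie_commutators_subset_iff by (simp add: eval_nat_numeral)
qed

end

section \<open>Cyclic derived subgroup\<close>

context group_algebra_over_field
begin

lemma minus_pointwise:
  assumes "f \<in> carrier A" "h \<in> carrier A" "x \<in> carrier G"
  shows "(f \<ominus>\<^bsub>A\<^esub> h) x = f x \<ominus>\<^bsub>K\<^esub> h x"
proof -
  have "(f \<ominus>\<^bsub>A\<^esub> h) \<oplus>\<^bsub>A\<^esub> h = f"
    using assms by (simp add: a_minus_def A.a_assoc A.l_neg)
  then have "(f \<ominus>\<^bsub>A\<^esub> h) x \<oplus>\<^bsub>K\<^esub> h x = f x"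
    using add_eq[OF assms(3)] by metis
  moreover have "(f \<ominus>\<^bsub>A\<^esub> h) x \<in> carrier K" "h x \<in> carrier K"
    using assms group_algebra_carrierD(3)[of _ x] A.minus_closed by auto
  ultimately have "(f \<ominus>\<^bsub>A\<^esub> h) x = f x \<oplus>\<^bsub>K\<^esub> \<ominus>\<^bsub>K\<^esub> h x"
    by (metis K.add.inv_solve_right' K.a_closed)
  then show ?thesis by (simp add: a_minus_def)
qed

text \<open>As a polynomial in x, (x - 1)^m is monic of degree m, and for m < q the powers up to x^m
  are distinct, so the leading coefficient can be read off at x^m. The bound on the support keeps
  the induction going.\<close>

lemma elt_minus_one_pow_leading_coeff:
  assumes x: "x \<in> carrier G" and inj: "inj_on (\<lambda>i::nat. x [^]\<^bsub>G\<^esub> i) {..<q}"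
  shows "m < q \<Longrightarrow> ((elt x \<ominus>\<^bsub>A\<^esub> \<one>\<^bsub>A\<^esub>) [^]\<^bsub>A\<^esub> m) (x [^]\<^bsub>G\<^esub> m) = \<one>\<^bsub>K\<^esub> \<and>
    (\<forall>y \<in> carrier G. (\<forall>i\<le>m. y \<noteq> x [^]\<^bsub>G\<^esub> i) \<longrightarrow> ((elt x \<ominus>\<^bsub>A\<^esub> \<one>\<^bsub>A\<^esub>) [^]\<^bsub>A\<^esub> m) y = \<zero>\<^bsub>K\<^esub>)"
proof (induction m)
  case 0
  then show ?case by (auto simp: one_eq monomial_eq)
next
  case (Suc m)
  let ?u = "elt x \<ominus>\<^bsub>A\<^esub> \<one>\<^bsub>A\<^esub>"
  let ?f = "?u [^]\<^bsub>A\<^esub> m"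
  have uc: "?u \<in> carrier A" by (rule A.minus_closed) simp_all
  then have f: "?f \<in> carrier A" by simp
  have "?u [^]\<^bsub>A\<^esub> Suc m = ?f \<otimes>\<^bsub>A\<^esub> elt x \<ominus>\<^bsub>A\<^esub> ?f"
    using f by (simp add: a_minus_def A.r_distr A.r_minus)
  then have step: "(?u [^]\<^bsub>A\<^esub> Suc m) y = ?f (y \<otimes>\<^bsub>G\<^esub> inv\<^bsub>G\<^esub> x) \<ominus>\<^bsub>K\<^esub> ?f y" if "y \<in> carrier G" for y
    using that f x group_algebra_carrierD(3)[OF f] by (simp add: minus_pointwise mult_monomial)
  have xm: "x [^]\<^bsub>G\<^esub> Suc m \<otimes>\<^bsub>G\<^esub> inv\<^bsub>G\<^esub> x = x [^]\<^bsub>G\<^esub> m"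
    using x by (simp add: G.m_assoc)
  have ne: "x [^]\<^bsub>G\<^esub> Suc m \<noteq> x [^]\<^bsub>G\<^esub> i" if "i \<le> m" for i
    using inj_onD[OF inj, of "Suc m" i] Suc.prems that by auto
  have "?f (x [^]\<^bsub>G\<^esub> Suc m) = \<zero>\<^bsub>K\<^esub>"
    using Suc ne x by (simp del: G.nat_pow_Suc)
  then have "(?u [^]\<^bsub>A\<^esub> Suc m) (x [^]\<^bsub>G\<^esub> Suc m) = \<one>\<^bsub>K\<^esub>"
    unfolding step[OF G.nat_pow_closed[OF x]] xm using Suc by (simp add: a_minus_def)
  moreover have "(?u [^]\<^bsub>A\<^esub> Suc m) y = \<zero>\<^bsub>K\<^esub>" if y: "y \<in> carrier G" "\<forall>i\<le>Suc m. y \<noteq> x [^]\<^bsub>G\<^esub> i" for y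
  proof -
    have "y \<otimes>\<^bsub>G\<^esub> inv\<^bsub>G\<^esub> x \<noteq> x [^]\<^bsub>G\<^esub> i" if "i \<le> m" for i
    proof
      assume "y \<otimes>\<^bsub>G\<^esub> inv\<^bsub>G\<^esub> x = x [^]\<^bsub>G\<^esub> i"
      then have "y = x [^]\<^bsub>G\<^esub> Suc i" using x y by (metis G.inv_solve_right' G.nat_pow_Suc G.nat_pow_closed)
      then show False using y that by blast
    qed
    then show ?thesis
      unfolding step[OF y(1)] using Suc x y by (simp add: a_minus_def)
  qed
  ultimately show ?case by blast
qed

text \<open>The filtration is by powers of u = x - 1, with d = 2 because (x,g) is the cube of a
  power of x. For q = 3^n weight q vanishes, so the error term is 0 and the commutator equals
  u^(q-1) times units.\<close>

lemma lie_commutators_cyclic_nonzero: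
  assumes a: "a \<in> carrier G" and b: "b \<in> carrier G"
    and x_def: "x = a \<otimes>\<^bsub>G\<^esub> b \<otimes>\<^bsub>G\<^esub> inv\<^bsub>G\<^esub> a \<otimes>\<^bsub>G\<^esub> inv\<^bsub>G\<^esub> b"
    and inj: "inj_on (\<lambda>i::nat. x [^]\<^bsub>G\<^esub> i) {..<3 ^ n}" and xn: "x [^]\<^bsub>G\<^esub> (3 ^ n :: nat) = \<one>\<^bsub>G\<^esub>"
    and comm: "\<And>g h. \<lbrakk>g \<in> carrier G; h \<in> carrier G\<rbrakk> \<Longrightarrow>
      \<exists>i::nat. g \<otimes>\<^bsub>G\<^esub> h \<otimes>\<^bsub>G\<^esub> inv\<^bsub>G\<^esub> g \<otimes>\<^bsub>G\<^esub> inv\<^bsub>G\<^esub> h = x [^]\<^bsub>G\<^esub> i"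
    and xcomm: "\<And>g. g \<in> carrier G \<Longrightarrow>
      \<exists>i::nat. x \<otimes>\<^bsub>G\<^esub> g \<otimes>\<^bsub>G\<^esub> inv\<^bsub>G\<^esub> x \<otimes>\<^bsub>G\<^esub> inv\<^bsub>G\<^esub> g = x [^]\<^bsub>G\<^esub> (3 * i)"
    and three: "\<one>\<^bsub>A\<^esub> \<oplus>\<^bsub>A\<^esub> \<one>\<^bsub>A\<^esub> \<oplus>\<^bsub>A\<^esub> \<one>\<^bsub>A\<^esub> = \<zero>\<^bsub>A\<^esub>"
  shows "\<not> lie_commutators A (3 ^ n) \<subseteq> {\<zero>\<^bsub>A\<^esub>}"
proof -
  have x: "x \<in> carrier G" unfolding x_def using a b by simp
  let ?u = "elt x \<ominus>\<^bsub>A\<^esub> \<one>\<^bsub>A\<^esub>" and ?q = "3 ^ n :: nat"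
  have uc: "?u \<in> carrier A" by (rule A.minus_closed) simp_all
  have zc: "\<zero>\<^bsub>A\<^esub> \<in> carrier A" by simp
  have z_central: "lie_bracket A \<zero>\<^bsub>A\<^esub> r = \<zero>\<^bsub>A\<^esub>" if "r \<in> carrier A" for r
    using that by simp
  \<comment> \<open>Setting v = 0 leaves only the powers of u.\<close>
  let ?J = "A.weight_filtration ?u \<zero>\<^bsub>A\<^esub>"
  note wf = A.weight_filtration_closed[OF uc zc z_central]
    A.weight_filtration_mult_right[OF uc zc z_central]
  have T: "?J w \<subseteq> carrier A" "\<zero>\<^bsub>A\<^esub> \<in> ?J w"
    "\<And>f h. \<lbrakk>f \<in> ?J w; h \<in> ?J w\<rbrakk> \<Longrightarrow> f \<oplus>\<^bsub>A\<^esub> h \<in> ?J w"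
    "\<And>f h. \<lbrakk>f \<in> ?J w; h \<in> carrier A\<rbrakk> \<Longrightarrow> f \<otimes>\<^bsub>A\<^esub> h \<in> ?J w" for w
    using wf by (auto intro: A.weight_filtration.zero A.weight_filtration.add)
  have gen: "?u [^]\<^bsub>A\<^esub> (w::nat) \<otimes>\<^bsub>A\<^esub> s \<in> ?J w" if "s \<in> carrier A" for w s
    using A.weight_filtration.gen[of w w 0 s ?u "\<zero>\<^bsub>A\<^esub>"] that by simp
  have pow: "elt (x [^]\<^bsub>G\<^esub> (e * i)) \<ominus>\<^bsub>A\<^esub> \<one>\<^bsub>A\<^esub> \<in> ?J e"
    if e: "(elt x [^]\<^bsub>A\<^esub> e) \<ominus>\<^bsub>A\<^esub> \<one>\<^bsub>A\<^esub> = ?u [^]\<^bsub>A\<^esub> e" for e i :: nat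
  proof -
    obtain s where "s \<in> carrier A"
      "(elt x [^]\<^bsub>A\<^esub> e) [^]\<^bsub>A\<^esub> i \<ominus>\<^bsub>A\<^esub> \<one>\<^bsub>A\<^esub> = (elt x [^]\<^bsub>A\<^esub> e \<ominus>\<^bsub>A\<^esub> \<one>\<^bsub>A\<^esub>) \<otimes>\<^bsub>A\<^esub> s"
      using A.pow_minus_one_factor[of "elt x [^]\<^bsub>A\<^esub> e" i] by auto
    then show ?thesis
      using gen x e by (simp add: A.nat_pow_pow elt_pow G.nat_pow_pow)
  qed
  have bracket: "lie_bracket A r s \<in> ?J 1" if rs: "r \<in> carrier A" "s \<in> carrier A" for r s
  proof (rule lie_bracket_mem[OF T _ rs])
    fix g h assume "g \<in> carrier G" "h \<in> carrier G"
    then obtain i :: nat where "g \<otimes>\<^bsub>G\<^esub> h \<otimes>\<^bsub>G\<^esub> inv\<^bsub>G\<^esub> g \<otimes>\<^bsub>G\<^esub> inv\<^bsub>G\<^esub> h = x [^]\<^bsub>G\<^esub> i"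
      using comm by blast
    then show "elt (g \<otimes>\<^bsub>G\<^esub> h \<otimes>\<^bsub>G\<^esub> inv\<^bsub>G\<^esub> g \<otimes>\<^bsub>G\<^esub> inv\<^bsub>G\<^esub> h) \<ominus>\<^bsub>A\<^esub> \<one>\<^bsub>A\<^esub> \<in> ?J 1"
      using pow[of 1 i] uc by simp
  qed
  have u_bracket: "lie_bracket A ?u r \<in> ?J (Suc 2)" if r: "r \<in> carrier A" for r
  proof -
    have "lie_bracket A (elt x) r \<in> ?J 3"
    proof (rule lie_bracket_elt_mem[OF T x _ r])
      fix g assume "g \<in> carrier G"
      then obtain i :: nat where "x \<otimes>\<^bsub>G\<^esub> g \<otimes>\<^bsub>G\<^esub> inv\<^bsub>G\<^esub> x \<otimes>\<^bsub>G\<^esub> inv\<^bsub>G\<^esub> g = x [^]\<^bsub>G\<^esub> (3 * i)"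
        using xcomm by blast
      then show "elt (x \<otimes>\<^bsub>G\<^esub> g \<otimes>\<^bsub>G\<^esub> inv\<^bsub>G\<^esub> x \<otimes>\<^bsub>G\<^esub> inv\<^bsub>G\<^esub> g) \<ominus>\<^bsub>A\<^esub> \<one>\<^bsub>A\<^esub> \<in> ?J 3"
        using pow[of 3 i] A.minus_one_cubed[OF three, of "elt x"] by simp
    qed
    then show ?thesis using r by (simp add: A.lie_bracket_minus_one_left eval_nat_numeral)
  qed
  have "?u [^]\<^bsub>A\<^esub> ?q = \<zero>\<^bsub>A\<^esub>"
    using A.minus_one_pow_3_pow[OF three, of "elt x" n] x xn
    by (simp add: elt_pow one_eq[symmetric] a_minus_def A.r_neg)
  \<comment> \<open>Here e = 1, since v itself is 0, and the bound q + 2 e - 2 equals q.\<close>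
  then have Jq: "?J (Suc (?q - 1)) = {\<zero>\<^bsub>A\<^esub>}"
    by (intro A.weight_filtration_eq_zero[OF uc zc z_central, of ?q 1]) auto
  have ab: "elt a \<otimes>\<^bsub>A\<^esub> elt b = (\<one>\<^bsub>A\<^esub> \<oplus>\<^bsub>A\<^esub> ?u) \<otimes>\<^bsub>A\<^esub> elt b \<otimes>\<^bsub>A\<^esub> elt a"
  proof -
    have "\<one>\<^bsub>A\<^esub> \<oplus>\<^bsub>A\<^esub> ?u = elt x"
      using A.r_neg2[of "\<one>\<^bsub>A\<^esub>" "elt x"] by (simp add: a_minus_def A.a_comm)
    moreover have "a \<otimes>\<^bsub>G\<^esub> b = x \<otimes>\<^bsub>G\<^esub> b \<otimes>\<^bsub>G\<^esub> a"
      unfolding x_def using a b by (simp add: G.m_assoc)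
    ultimately show ?thesis using a b x by (simp add: elt_mult)
  qed
  let ?g = "b \<otimes>\<^bsub>G\<^esub> a [^]\<^bsub>G\<^esub> (?q - 1)"
  have g: "?g \<in> carrier G" using a b by simp
  let ?c = "foldl (lie_bracket A) (elt b) (replicate (?q - 1) (elt a))"
  let ?e = "(\<ominus>\<^bsub>A\<^esub> \<one>\<^bsub>A\<^esub>) [^]\<^bsub>A\<^esub> (?q - 1)" and ?w = "?u [^]\<^bsub>A\<^esub> (?q - 1)"
  obtain j where "j \<in> ?J (Suc (?q - 1))"
    "?c = ?e \<otimes>\<^bsub>A\<^esub> (?w \<otimes>\<^bsub>A\<^esub> (elt b \<otimes>\<^bsub>A\<^esub> elt a [^]\<^bsub>A\<^esub> (?q - 1))) \<oplus>\<^bsub>A\<^esub> j"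
    using A.iterated_bracket_mod_weight_filtration
      [OF uc zc z_central _ u_bracket bracket _ _ ab, of "?q - 1"] by auto
  then have c: "?c = ?e \<otimes>\<^bsub>A\<^esub> (?w \<otimes>\<^bsub>A\<^esub> elt ?g)"
    using Jq a b uc by (simp add: elt_pow elt_mult)
  have "?c \<noteq> \<zero>\<^bsub>A\<^esub>"
  proof
    assume c0: "?c = \<zero>\<^bsub>A\<^esub>"
    have e: "?e \<in> Units A"
      by (intro A.Units_pow_closed A.Units_minus_one_closed)
    have wg: "?w \<otimes>\<^bsub>A\<^esub> elt ?g \<in> carrier A" using uc by simp
    have "?e \<otimes>\<^bsub>A\<^esub> (?w \<otimes>\<^bsub>A\<^esub> elt ?g) = ?e \<otimes>\<^bsub>A\<^esub> \<zero>\<^bsub>A\<^esub>"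
      unfolding c[symmetric] c0 by (rule A.r_null[OF A.Units_closed[OF e], symmetric])
    then have "?w \<otimes>\<^bsub>A\<^esub> elt ?g = \<zero>\<^bsub>A\<^esub>"
      using A.Units_l_cancel[OF e wg zc] by blast
    \<comment> \<open>Multiplication by g shifts coefficients, so this one is the leading
      coefficient 1 of u^(q-1).\<close>
    then have "(?w \<otimes>\<^bsub>A\<^esub> elt ?g) (x [^]\<^bsub>G\<^esub> (?q - 1) \<otimes>\<^bsub>G\<^esub> ?g) = \<zero>\<^bsub>K\<^esub>"
      using x g by (simp add: zero_eq)
    moreover have "x [^]\<^bsub>G\<^esub> (?q - 1) \<otimes>\<^bsub>G\<^esub> ?g \<otimes>\<^bsub>G\<^esub> inv\<^bsub>G\<^esub> ?g = x [^]\<^bsub>G\<^esub> (?q - 1)"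
      using x g by (simp add: G.m_assoc del: G.inv_mult_group)
    moreover have "?w (x [^]\<^bsub>G\<^esub> (?q - 1)) = \<one>\<^bsub>K\<^esub>"
      using elt_minus_one_pow_leading_coeff[OF x inj, of "?q - 1"] by simp
    moreover have "?w \<in> carrier A" "x [^]\<^bsub>G\<^esub> (?q - 1) \<otimes>\<^bsub>G\<^esub> ?g \<in> carrier G"
      using uc x g by auto
    ultimately show False
      using mult_monomial[OF K.one_closed g, of ?w "x [^]\<^bsub>G\<^esub> (?q - 1) \<otimes>\<^bsub>G\<^esub> ?g"] by simp
  qed
  moreover have "?c \<in> lie_commutators A ?q"
    unfolding lie_commutators_def by (fastforce intro!: exI[of _ "elt b"] exI[of _ "replicate (?q - 1) (elt a)"])
  ultimately show ?thesis by blast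
qed

end

section \<open>Central extensions by a group of order 3\<close>

text \<open>An exponent prime to 3 is its own inverse modulo 3; this recovers an element from its
  i-th power using natural exponents only.\<close>

lemma square_eq_1_mod_3:
  fixes i :: nat
  assumes "\<not> 3 dvd i"
  shows "\<exists>t. i * i = 1 + 3 * t"
proof -
  have "i mod 3 = 1 \<or> i mod 3 = 2" using assms by presburger
  then have "(i * i) mod 3 = 1" by (auto simp: mod_mult_eq[of i 3 i, symmetric])
  then have "i * i = 1 + 3 * (i * i div 3)" using div_mult_mod_eq[of "i * i" 3] by linarith
  then show ?thesis ..
qed

context group
begin

abbreviation comm :: "'a \<Rightarrow> 'a \<Rightarrow> 'a" where
  "comm x y \<equiv> x \<otimes> y \<otimes> inv x \<otimes> inv y"

lemma comm_mult_left:
  assumes "x \<in> carrier G" "y \<in> carrier G" "g \<in> carrier G"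
  shows "comm (x \<otimes> y) g = (x \<otimes> comm y g \<otimes> inv x) \<otimes> comm x g"
proof -
  have *: "inv x \<otimes> (x \<otimes> w) = w" "inv g \<otimes> (g \<otimes> w) = w" if "w \<in> carrier G" for w
    using assms that by (simp_all add: m_assoc[symmetric])
  show ?thesis using assms by (simp add: m_assoc inv_mult_group *)
qed

lemma comm_in_normal:
  assumes N: "N \<lhd> G" and "x \<in> N" "g \<in> carrier G"
  shows "comm x g \<in> N"
proof -
  have s: "subgroup N G" using N by (rule normal_imp_subgroup)
  have x: "x \<in> carrier G" using subgroup.mem_carrier[OF s] assms by blast
  have "g \<otimes> inv x \<otimes> inv g \<in> N"
    using normal_invE(2)[OF N assms(3)] assms subgroup.m_inv_closed[OF s] by simp
  then have "x \<otimes> (g \<otimes> inv x \<otimes> inv g) \<in> N"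
    using subgroup.m_closed[OF s] assms by simp
  then show ?thesis using x assms by (simp add: m_assoc)
qed

lemma comm_in_derived:
  "\<lbrakk>x \<in> carrier G; y \<in> carrier G\<rbrakk> \<Longrightarrow> comm x y \<in> derived G (carrier G)"
  unfolding derived_def by (rule generate.incl) blast

text \<open>(z^i, g) is a product of conjugates of (z, g).\<close>

lemma comm_pow_in_normal:
  assumes A: "A \<lhd> G" and z: "z \<in> carrier G" and g: "g \<in> carrier G" and zg: "comm z g \<in> A"
  shows "comm (z [^] (i::nat)) g \<in> A"
proof (induction i)
  case 0
  then show ?case using g subgroup.one_closed[OF normal_imp_subgroup[OF A]] by simp
next
  case (Suc i)
  have "comm (z [^] i \<otimes> z) g = (z [^] i \<otimes> comm z g \<otimes> inv (z [^] i)) \<otimes> comm (z [^] i) g"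
    using z g by (intro comm_mult_left) auto
  moreover have "z [^] i \<otimes> comm z g \<otimes> inv (z [^] i) \<in> A"
    using z zg normal_invE(2)[OF A] by simp
  ultimately show ?case using Suc subgroup.m_closed[OF normal_imp_subgroup[OF A]] by simp
qed

text \<open>If every element of \<open>N - A\<close> had a commutator outside \<open>A\<close>, iterating would produce
  elements of \<open>N - A\<close> arbitrarily deep in the lower central series.\<close>

lemma exists_central_modulo:
  assumes nilp: "nilpotent_group G" and A: "A \<lhd> G" and N: "N \<lhd> G" and NA: "\<not> N \<subseteq> A"
  shows "\<exists>z \<in> N - A. \<forall>g \<in> carrier G. comm z g \<in> A"
proof (rule ccontr)
  assume none: "\<not> ?thesis"
  have sN: "subgroup N G" and sA: "subgroup A G" using A N normal_imp_subgroup by auto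
  have "\<exists>y \<in> N - A. y \<in> lower_central G i" for i
  proof (induction i)
    case 0
    then show ?case using NA subgroup.subset[OF sN] by auto
  next
    case (Suc i)
    then obtain y where y: "y \<in> N - A" "y \<in> lower_central G i" by blast
    then obtain g where g: "g \<in> carrier G" "comm y g \<notin> A" using none by blast
    have "comm y g \<in> N" using comm_in_normal[OF N] y g by blast
    moreover have "comm y g \<in> lower_central G (Suc i)"
      unfolding lower_central.simps using y g by (intro generate.incl) blast
    ultimately show ?case using g by blast
  qed
  moreover obtain c where "lower_central G c = {\<one>}" using nilp unfolding nilpotent_group_def by blast
  ultimately obtain y where "y \<in> N - A" "y = \<one>" by blast
  then show False using subgroup.one_closed[OF sA] by blast
qed

lemma normal_conj_right:
  assumes A: "A \<lhd> G" and "a \<in> A" "z \<in> carrier G"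
  obtains a' where "a' \<in> A" "a \<otimes> z = z \<otimes> a'"
proof -
  have a: "a \<in> carrier G" using normal_imp_subgroup[OF A] subgroup.mem_carrier assms by metis
  have "inv z \<otimes> a \<otimes> z \<in> A" using normal.inv_op_closed1[OF A] assms by blast
  moreover have "a \<otimes> z = z \<otimes> (inv z \<otimes> a \<otimes> z)"
    using a assms by (simp add: m_assoc[symmetric])
  ultimately show ?thesis using that by blast
qed

text \<open>z a and z have the same image in G/A; this records the consequence for powers without
  forming the quotient.\<close>

lemma pow_mult_normal:
  assumes A: "A \<lhd> G" and a: "a \<in> A" and z: "z \<in> carrier G"
  shows "\<exists>a' \<in> A. (z \<otimes> a) [^] (k::nat) = z [^] k \<otimes> a'"
proof (induction k)
  case 0
  show ?case using subgroup.one_closed[OF normal_imp_subgroup[OF A]] by (intro bexI[of _ \<one>]) auto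
next
  case (Suc k)
  then obtain a' where a': "a' \<in> A" "(z \<otimes> a) [^] k = z [^] k \<otimes> a'" by blast
  obtain a'' where a'': "a'' \<in> A" "a' \<otimes> z = z \<otimes> a''" using normal_conj_right[OF A a'(1) z] .
  have c: "a \<in> carrier G" "a' \<in> carrier G" "a'' \<in> carrier G"
    using normal_imp_subgroup[OF A] subgroup.mem_carrier a a' a'' by metis+
  have "(z \<otimes> a) [^] Suc k = z [^] k \<otimes> (a' \<otimes> z) \<otimes> a"
    using a' c z by (simp add: m_assoc)
  also have "\<dots> = z [^] Suc k \<otimes> (a'' \<otimes> a)"
    unfolding a''(2) using c z by (simp add: m_assoc)
  finally show ?case
    using subgroup.m_closed[OF normal_imp_subgroup[OF A] a''(1) a] by blast
qed

lemma subgroup_nat_pow: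
  assumes "subgroup A G" "x \<in> A"
  shows "x [^] (k::nat) \<in> A"
  by (induction k) (use assms in \<open>auto simp: subgroup.one_closed subgroup.m_closed\<close>)

text \<open>B/A is central in G/A, of order exactly 3 and generated by the image of z. Exponents
  range over all naturals, which spares reductions modulo 3.\<close>

definition central_extension_by_3 :: "'a set \<Rightarrow> 'a \<Rightarrow> 'a set \<Rightarrow> bool" where
  "central_extension_by_3 A z B \<longleftrightarrow> A \<lhd> G \<and> z \<in> carrier G \<and> z \<notin> A \<and> z [^] (3::nat) \<in> A \<and>
     (\<forall>g \<in> carrier G. comm z g \<in> A) \<and> B = {z [^] i \<otimes> a | (i::nat) a. a \<in> A}"

context
  fixes A z B
  assumes ext: "central_extension_by_3 A z B"
begin

lemma ext_facts:
  shows "A \<lhd> G" "subgroup A G" "A \<subseteq> carrier G" "z \<in> carrier G" "z \<notin> A" "z [^] (3::nat) \<in> A"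
    and "g \<in> carrier G \<Longrightarrow> comm z g \<in> A"
    and "b \<in> B \<longleftrightarrow> (\<exists>i::nat. \<exists>a \<in> A. b = z [^] i \<otimes> a)"
  using ext normal_imp_subgroup subgroup.subset unfolding central_extension_by_3_def by blast+

lemma ext_pow_3: "z [^] (3 * i :: nat) \<in> A"
  using subgroup_nat_pow[OF ext_facts(2,6), of i] ext_facts(4) by (simp add: nat_pow_pow)

lemma ext_comm: 
  assumes "b \<in> B" and g: "g \<in> carrier G"
  shows "comm b g \<in> A"
proof -
  note A = ext_facts(1-6)
  have zi: "comm (z [^] (i::nat)) g \<in> A" for i
    by (rule comm_pow_in_normal[OF A(1,4) g ext_facts(7)[OF g]])
  obtain i :: nat and a where b: "a \<in> A" "b = z [^] i \<otimes> a" using assms ext_facts(8) by blast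
  have ac: "a \<in> carrier G" using b A by blast
  have "comm b g = (z [^] i \<otimes> comm a g \<otimes> inv (z [^] i)) \<otimes> comm (z [^] i) g"
    unfolding b(2) using A g ac by (intro comm_mult_left) auto
  moreover have "z [^] i \<otimes> comm a g \<otimes> inv (z [^] i) \<in> A"
    using comm_in_normal[OF A(1) b(1) g] A normal_invE(2)[OF A(1)] by simp
  ultimately show ?thesis using zi subgroup.m_closed[OF A(2)] by simp
qed

lemma ext_cube: "b \<in> B \<Longrightarrow> b [^] (3::nat) \<in> A"
proof -
  assume "b \<in> B"
  then obtain i :: nat and a where b: "a \<in> A" "b = z [^] i \<otimes> a" using ext_facts(8) by blast
  obtain a' where "a' \<in> A" "b [^] (3::nat) = (z [^] i) [^] (3::nat) \<otimes> a'"
    using pow_mult_normal[OF ext_facts(1) b(1), of "z [^] i" 3] b ext_facts(4) by auto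
  moreover have "(z [^] i) [^] (3::nat) \<in> A"
    using ext_pow_3[of i] ext_facts(4) by (simp add: nat_pow_pow mult.commute)
  ultimately show ?thesis using subgroup.m_closed[OF ext_facts(2)] by simp
qed

lemma ext_superset: "A \<subseteq> B"
proof
  fix a assume "a \<in> A"
  moreover from this have "a = z [^] (0::nat) \<otimes> a" using ext_facts(3) by auto
  ultimately show "a \<in> B" using ext_facts(8) by blast
qed

lemma ext_normal: "B \<lhd> G"
proof (rule normal_invI)
  note A = ext_facts(1-6)
  have Bc: "B \<subseteq> carrier G"
  proof
    fix b assume "b \<in> B"
    then obtain i :: nat and a where "a \<in> A" "b = z [^] i \<otimes> a" using ext_facts(8) by blast
    then show "b \<in> carrier G" using A(3,4) by blast
  qed
  show "subgroup B G"
  proof (rule subgroupI)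
    show "B \<noteq> {}" using ext_superset subgroup.one_closed[OF A(2)] by blast
  next
    fix b assume "b \<in> B"
    then have "b \<in> carrier G" and "b [^] (3::nat) \<in> A" using Bc ext_cube by auto
    then obtain i :: nat and a where b: "a \<in> A" "b = z [^] i \<otimes> a"
      using ext_facts(8) \<open>b \<in> B\<close> by blast
    have ac: "a \<in> carrier G" using b A by blast
    obtain a' where a': "a' \<in> A" "inv a \<otimes> z [^] (2 * i) = z [^] (2 * i) \<otimes> a'"
      by (rule normal_conj_right[OF A(1) subgroup.m_inv_closed[OF A(2) b(1)] nat_pow_closed[OF A(4)]])
    have a'c: "a' \<in> carrier G" using a' A by blast
    \<comment> \<open>B is described by natural exponents, so z^(-i) is replaced by z^(2 i), up to
      z^(3 i) in A.\<close>
    have "inv (z [^] i) = z [^] (2 * i) \<otimes> inv (z [^] (3 * i))"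
    proof -
      have "z [^] i \<otimes> (z [^] (2 * i) \<otimes> inv (z [^] (3 * i))) = \<one>"
        using A by (simp add: m_assoc[symmetric] nat_pow_mult)
      from inv_equality[OF this] show ?thesis using A by (metis inv_closed inv_inv m_closed nat_pow_closed)
    qed
    then have "inv b = z [^] (2 * i) \<otimes> (a' \<otimes> inv (z [^] (3 * i)))"
      unfolding b(2) using A ac a'c a'(2) by (simp add: inv_mult_group m_assoc[symmetric])
    moreover have "a' \<otimes> inv (z [^] (3 * i)) \<in> A"
      using a' ext_pow_3 A(2) by (simp add: subgroup.m_closed subgroup.m_inv_closed)
    ultimately show "inv b \<in> B" using ext_facts(8) by blast
  next
    fix b c assume "b \<in> B" "c \<in> B"
    then obtain i j :: nat and a d where b: "a \<in> A" "b = z [^] i \<otimes> a" "d \<in> A" "c = z [^] j \<otimes> d"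
      using ext_facts(8) by blast
    obtain a' where a': "a' \<in> A" "a \<otimes> z [^] j = z [^] j \<otimes> a'"
      by (rule normal_conj_right[OF A(1) b(1) nat_pow_closed[OF A(4)]])
    have cc: "a \<in> carrier G" "d \<in> carrier G" "a' \<in> carrier G" using b a' A by blast+
    have "b \<otimes> c = z [^] i \<otimes> (a \<otimes> z [^] j) \<otimes> d" unfolding b using cc A by (simp add: m_assoc)
    also have "\<dots> = z [^] (i + j) \<otimes> (a' \<otimes> d)"
      unfolding a'(2) using cc A by (simp add: m_assoc[symmetric] nat_pow_mult)
    finally show "b \<otimes> c \<in> B" using ext_facts(8) subgroup.m_closed[OF A(2) a'(1) b(3)] by blast
  qed (use Bc in auto)
  then have sB: "subgroup B G" .
  fix g b assume g: "g \<in> carrier G" and b: "b \<in> B"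
  have bc: "b \<in> carrier G" using b Bc by blast
  \<comment> \<open>Conjugation changes b only by the inverse of (b,g), which lies in A and hence in
    B.\<close>
  have "inv (comm b g) \<in> B"
    using ext_comm[OF b g] ext_superset subgroup.m_inv_closed[OF sB] by blast
  then have "inv (comm b g) \<otimes> b \<in> B" using subgroup.m_closed[OF sB] b by blast
  moreover have "inv (comm b g) \<otimes> b = g \<otimes> b \<otimes> inv g"
    using g bc by (simp add: inv_mult_group m_assoc)
  ultimately show "g \<otimes> b \<otimes> inv g \<in> B" by simp
qed

text \<open>A group of order 3 is generated by any nontrivial element: if w = z^i a, then i is prime
  to 3 and w^i agrees with z modulo A.\<close>

lemma ext_generated:
  assumes w: "w \<in> B" "w \<notin> A" and b: "b \<in> B"
  shows "\<exists>i::nat. \<exists>a \<in> A. b = w [^] i \<otimes> a"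
proof -
  note A = ext_facts(1-6)
  obtain i :: nat and a where i: "a \<in> A" "w = z [^] i \<otimes> a" using w ext_facts(8) by blast
  have "\<not> 3 dvd i"
  proof
    assume "3 dvd i"
    then have "z [^] i \<in> A" using ext_pow_3 by (metis dvdE)
    then show False using i w subgroup.m_closed[OF A(2)] by simp
  qed
  then obtain t where t: "i * i = 1 + 3 * t" using square_eq_1_mod_3 by blast
  obtain a1 where a1: "a1 \<in> A" "w [^] i = (z [^] i) [^] i \<otimes> a1"
    using pow_mult_normal[OF A(1) i(1), of "z [^] i" i] i A by auto
  obtain j :: nat and d where j: "d \<in> A" "b = z [^] j \<otimes> d" using b ext_facts(8) by blast
  have wc: "w \<in> carrier G" using i A by auto
  have c1: "a1 \<in> carrier G" using a1 A by blast
  let ?e = "z [^] (3 * t) \<otimes> a1"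
  have e: "?e \<in> A" using subgroup.m_closed[OF A(2) ext_pow_3 a1(1)] .
  have "z [^] (i * i) = z \<otimes> z [^] (3 * t)"
    unfolding t using nat_pow_Suc2[OF A(4), of "3 * t"] by (metis plus_1_eq_Suc)
  then have "w [^] i = z \<otimes> ?e"
    using A c1 a1 by (simp add: nat_pow_pow m_assoc)
  then have "z = w [^] i \<otimes> inv ?e"
    using inv_solve_right[of z "w [^] i" ?e] A(4) c1 wc by simp
  moreover have "inv ?e \<in> A" using e subgroup.m_inv_closed[OF A(2)] by blast
  ultimately obtain a2 where a2: "a2 \<in> A" "z [^] j = (w [^] i) [^] j \<otimes> a2"
    using pow_mult_normal[OF A(1), of "inv ?e" "w [^] i" j] wc by auto
  have "b = w [^] (i * j) \<otimes> (a2 \<otimes> d)"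
    unfolding j(2) a2(2)
    using subsetD[OF A(3) a2(1)] subsetD[OF A(3) j(1)] wc by (simp add: m_assoc nat_pow_pow)
  then show ?thesis using subgroup.m_closed[OF A(2) a2(1) j(1)] by blast
qed

text \<open>The cosets A, zA and z^2 A are distinct and exhaust B.\<close>

lemma ext_card: "card B = 3 * card A"
proof -
  note A = ext_facts(1-6)
  have "bij_betw (\<lambda>(i, a). z [^] i \<otimes> a) ({..<3::nat} \<times> A) B"
    unfolding bij_betw_def
  proof
    have no: False if "i < j" "j < 3" "a \<in> A" "d \<in> A" "z [^] i \<otimes> a = z [^] j \<otimes> d" for i j :: nat and a d
    proof -
      have cc: "a \<in> carrier G" "d \<in> carrier G" using that A by blast+
      have "z [^] i \<otimes> a = z [^] i \<otimes> (z [^] (j - i) \<otimes> d)"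
        using that cc A by (simp add: m_assoc[symmetric] nat_pow_mult)
      then have "a = z [^] (j - i) \<otimes> d" using cc A by simp
      then have "z [^] (j - i) = a \<otimes> inv d" using cc A by (simp add: m_assoc)
      then have zA: "z [^] (j - i) \<in> A"
        using that A(2) by (simp add: subgroup.m_closed subgroup.m_inv_closed)
      consider "j - i = 1" | "j - i = 2" using \<open>i < j\<close> \<open>j < 3\<close> by linarith
      then show False
      proof cases
        case 1
        then show ?thesis using zA A by simp
      next
        case 2
        \<comment> \<open>With z^2 and z^3 in A, so would be z = (z^2)^(-1) z^3.\<close>
        have "z [^] (3::nat) = z [^] (2::nat) \<otimes> z"
          by (simp add: eval_nat_numeral)
        then have "inv (z [^] (2::nat)) \<otimes> z [^] (3::nat) = z"
          using A by (simp add: m_assoc[symmetric])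
        then have "z \<in> A" using zA 2 A subgroup.m_closed[OF A(2)] subgroup.m_inv_closed[OF A(2)] by metis
        then show ?thesis using A by blast
      qed
    qed
    show "inj_on (\<lambda>(i, a). z [^] i \<otimes> a) ({..<3::nat} \<times> A)"
    proof (rule inj_onI, clarsimp)
      fix i j :: nat and a d assume h: "i < 3" "a \<in> A" "j < 3" "d \<in> A" "z [^] i \<otimes> a = z [^] j \<otimes> d"
      then have ij: "i = j" using no[of i j a d] no[of j i d a] by (metis linorder_neqE_nat)
      have "a \<in> carrier G" "d \<in> carrier G" using h A by blast+
      then show "i = j \<and> a = d" using h ij A by simp
    qed
    show "(\<lambda>(i, a). z [^] i \<otimes> a) ` ({..<3::nat} \<times> A) = B"
    proof
      show "(\<lambda>(i, a). z [^] i \<otimes> a) ` ({..<3::nat} \<times> A) \<subseteq> B" using ext_facts(8) by auto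
      show "B \<subseteq> (\<lambda>(i, a). z [^] i \<otimes> a) ` ({..<3::nat} \<times> A)"
      proof
        fix b assume "b \<in> B"
        then obtain i :: nat and a where b: "a \<in> A" "b = z [^] i \<otimes> a" using ext_facts(8) by blast
        have "z [^] i = z [^] (i mod 3) \<otimes> z [^] (3 * (i div 3))"
          using A by (simp add: nat_pow_mult)
        then have "b = z [^] (i mod 3) \<otimes> (z [^] (3 * (i div 3)) \<otimes> a)"
          unfolding b(2) using subsetD[OF A(3) b(1)] A(4) by (simp add: m_assoc)
        moreover have "z [^] (3 * (i div 3)) \<otimes> a \<in> A"
          using subgroup.m_closed[OF A(2) ext_pow_3 b(1)] .
        ultimately show "b \<in> (\<lambda>(i, a). z [^] i \<otimes> a) ` ({..<3::nat} \<times> A)"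
          by (intro image_eqI[of _ _ "(i mod 3, z [^] (3 * (i div 3)) \<otimes> a)"]) auto
      qed
    qed
  qed
  then have "card B = card ({..<3::nat} \<times> A)" by (metis bij_betw_same_card)
  then show ?thesis by (simp add: card_cartesian_product)
qed

end

section \<open>Existence of central extensions of order 3 in a nilpotent group\<close>

lemma pow_card_subgroup:
  assumes "subgroup N G" "x \<in> N"
  shows "x [^] card N = \<one>"
proof -
  interpret N: group "G\<lparr>carrier := N\<rparr>" using assms subgroup_imp_group by blast
  have "x [^]\<^bsub>G\<lparr>carrier := N\<rparr>\<^esub> order (G\<lparr>carrier := N\<rparr>) = \<one>\<^bsub>G\<lparr>carrier := N\<rparr>\<^esub>"
    using assms by (intro N.pow_order_eq_1) simp
  then show ?thesis by (simp add: order_def nat_pow_consistent[symmetric])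
qed

text \<open>An element y of N outside A that is central modulo A has 3-power order. The last of y,
  y^3, y^9, ... outside A has its cube in A and is still central modulo A.\<close>

lemma exists_central_extension_by_3:
  assumes nilp: "nilpotent_group G" and A: "A \<lhd> G" and N: "N \<lhd> G" and AN: "A \<subset> N"
    and card: "card N = 3 ^ m"
  shows "\<exists>z B. central_extension_by_3 A z B \<and> z \<in> N \<and> B \<subseteq> N"
proof -
  have sN: "subgroup N G" and sA: "subgroup A G" using A N normal_imp_subgroup by auto
  obtain y where y: "y \<in> N - A" "\<forall>g \<in> carrier G. comm y g \<in> A"
    using exists_central_modulo[OF nilp A N] AN by blast
  have yc: "y \<in> carrier G" using y subgroup.mem_carrier[OF sN] by blast
  have "y [^] (3 ^ m :: nat) \<in> A"
    using pow_card_subgroup[OF sN, of y] y card subgroup.one_closed[OF sA] by simp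
  moreover have "y [^] (3 ^ 0 :: nat) \<notin> A" using y yc by simp
  ultimately obtain j where j: "y [^] (3 ^ j :: nat) \<notin> A" "y [^] (3 ^ Suc j :: nat) \<in> A"
    using ex_least_nat_less[of "\<lambda>j. y [^] (3 ^ j :: nat) \<in> A" m] by blast
  let ?z = "y [^] (3 ^ j :: nat)"
  have comm_pow: "comm (y [^] (i::nat)) g \<in> A" if g: "g \<in> carrier G" for g i
    by (rule comm_pow_in_normal[OF A yc g]) (use y g in blast)
  let ?B = "{?z [^] i \<otimes> a | (i::nat) a. a \<in> A}"
  have "central_extension_by_3 A ?z ?B"
    unfolding central_extension_by_3_def
    using A yc j comm_pow by (auto simp: nat_pow_pow mult.commute)
  moreover have "?z \<in> N" using y subgroup_nat_pow[OF sN] by blast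
  moreover have "?B \<subseteq> N"
    using \<open>?z \<in> N\<close> AN subgroup_nat_pow[OF sN] subgroup.m_closed[OF sN] by blast
  ultimately show ?thesis by blast
qed

lemma normal_derived: "derived G (carrier G) \<lhd> G"
proof (rule normal_invI)
  let ?D = "derived G (carrier G)"
  show s: "subgroup ?D G" by (rule derived_is_subgroup) simp
  fix g d assume g: "g \<in> carrier G" and d: "d \<in> ?D"
  have dc: "d \<in> carrier G" using subgroup.mem_carrier[OF s d] .
  have "comm g d \<otimes> d \<in> ?D" using subgroup.m_closed[OF s comm_in_derived[OF g dc] d] .
  then show "g \<otimes> d \<otimes> inv g \<in> ?D" using g dc by (simp add: m_assoc)
qed

end

section \<open>The nilpotency index\<close>

lemma (in ring) lower_lie_power_eq_zero_iff:
  assumes "1 \<le> m"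
  shows "lower_lie_power R m = {\<zero>} \<longleftrightarrow> lie_commutators R m \<subseteq> {\<zero>}"
proof (cases "m = 1")
  case True
  have "lie_commutators R 1 = carrier R"
    unfolding lie_commutators_def by auto
  then show ?thesis using True unfolding lower_lie_power_def by auto
next
  case False
  have I: "ideal (Idl (lie_commutators R m)) R"
    by (rule genideal_ideal[OF lie_commutators_closed])
  have "Idl (lie_commutators R m) = {\<zero>} \<longleftrightarrow> lie_commutators R m \<subseteq> {\<zero>}"
  proof
    assume "lie_commutators R m \<subseteq> {\<zero>}"
    then have "Idl (lie_commutators R m) \<subseteq> {\<zero>}" by (intro genideal_minimal zeroideal)
    then show "Idl (lie_commutators R m) = {\<zero>}"
      using additive_subgroup.zero_closed[OF ideal.axioms(1)[OF I]] by blast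
  qed (use genideal_self[OF lie_commutators_closed] in blast)
  then show ?thesis using False assms unfolding lower_lie_power_def by simp
qed

lemma (in ring) ring_char_3:
  assumes "ring_char R = 3"
  shows "\<one> \<oplus> \<one> \<oplus> \<one> = \<zero>"
proof -
  let ?P = "\<lambda>m::nat. 0 < m \<and> add_pow R m \<one> = \<zero>"
  have ex: "\<exists>m. ?P m" and three: "(LEAST m. ?P m) = 3"
    using assms unfolding ring_char_def by (auto split: if_splits)
  have "add_pow R (3::nat) \<one> = \<zero>"
    using LeastI_ex[OF ex] unfolding three by blast
  then show ?thesis by (simp add: numeral_3_eq_3)
qed

context group_algebra_over_field
begin

lemma one_neq_zero: "\<one>\<^bsub>A\<^esub> \<noteq> \<zero>\<^bsub>A\<^esub>"
proof
  assume "\<one>\<^bsub>A\<^esub> = \<zero>\<^bsub>A\<^esub>"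
  then have "\<one>\<^bsub>A\<^esub> \<one>\<^bsub>G\<^esub> = \<zero>\<^bsub>A\<^esub> \<one>\<^bsub>G\<^esub>" by simp
  then show False by (simp add: one_eq monomial_eq zero_eq)
qed

lemma three_eq_zero:
  assumes "ring_char K = 3"
  shows "\<one>\<^bsub>A\<^esub> \<oplus>\<^bsub>A\<^esub> \<one>\<^bsub>A\<^esub> \<oplus>\<^bsub>A\<^esub> \<one>\<^bsub>A\<^esub> = \<zero>\<^bsub>A\<^esub>"
proof (rule group_algebra_eqI)
  fix y assume "y \<in> carrier G"
  then show "(\<one>\<^bsub>A\<^esub> \<oplus>\<^bsub>A\<^esub> \<one>\<^bsub>A\<^esub> \<oplus>\<^bsub>A\<^esub> \<one>\<^bsub>A\<^esub>) y = \<zero>\<^bsub>A\<^esub> y"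
    using K.ring_char_3[OF assms] by (simp add: add_eq one_eq monomial_eq zero_eq)
qed auto

text \<open>The commutator \<open>x\<close> of \<open>a\<close> and \<open>b\<close> generates \<open>G'\<close> modulo \<open>N\<close>. The subgroup \<open>M\<close> of
  index 3 in \<open>G'\<close> serves to show that conjugation changes \<open>x\<close> only by cubes modulo \<open>N\<close>.\<close>

definition cyclic_derived_modulo :: "'g set \<Rightarrow> nat \<Rightarrow> 'g \<Rightarrow> 'g \<Rightarrow> 'g set \<Rightarrow> bool" where
  "cyclic_derived_modulo N k a b M \<longleftrightarrow>
     a \<in> carrier G \<and> b \<in> carrier G \<and> M \<lhd> G \<and> N \<subseteq> M \<and>
     (\<forall>h \<in> derived G (carrier G). \<forall>g \<in> carrier G. G.comm h g \<in> M) \<and>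
     G.comm a b \<notin> M \<and> G.comm a b [^]\<^bsub>G\<^esub> (3::nat) \<in> M \<and>
     G.comm a b [^]\<^bsub>G\<^esub> (3 ^ k :: nat) \<in> N \<and>
     (\<forall>h \<in> derived G (carrier G). \<exists>i::nat. \<exists>c \<in> N. h = G.comm a b [^]\<^bsub>G\<^esub> i \<otimes>\<^bsub>G\<^esub> c)"

text \<open>Since (G',G) lies in M, so does (x,g) = x^i c, and with c in N inside M also x^i. As x
  has order 3 modulo M, this forces 3 to divide i.\<close>

lemma cyclic_derived_modulo_comm:
  assumes Q: "cyclic_derived_modulo N k a b M" and g: "g \<in> carrier G"
  shows "\<exists>i::nat. \<exists>c \<in> N. G.comm (G.comm a b) g = G.comm a b [^]\<^bsub>G\<^esub> (3 * i) \<otimes>\<^bsub>G\<^esub> c"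
proof -
  let ?x = "G.comm a b"
  have ab: "a \<in> carrier G" "b \<in> carrier G" and M: "M \<lhd> G" "N \<subseteq> M"
    and x: "?x \<notin> M" "?x [^]\<^bsub>G\<^esub> (3::nat) \<in> M"
    using Q unfolding cyclic_derived_modulo_def by auto
  have sM: "subgroup M G" by (rule normal_imp_subgroup[OF M(1)])
  have xc: "?x \<in> carrier G" using ab by simp
  have xD: "?x \<in> derived G (carrier G)" using G.comm_in_derived[OF ab] .
  have cD: "G.comm ?x g \<in> derived G (carrier G)" by (rule G.comm_in_derived[OF xc g])
  have cM: "G.comm ?x g \<in> M"
    using Q xD g unfolding cyclic_derived_modulo_def by metis
  obtain i :: nat and c where c: "c \<in> N" "G.comm ?x g = ?x [^]\<^bsub>G\<^esub> i \<otimes>\<^bsub>G\<^esub> c"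
    using Q cD unfolding cyclic_derived_modulo_def by metis
  have cMm: "c \<in> M" "c \<in> carrier G" using c M subgroup.mem_carrier[OF sM] by auto
  have "?x [^]\<^bsub>G\<^esub> i = G.comm ?x g \<otimes>\<^bsub>G\<^esub> inv\<^bsub>G\<^esub> c"
    using c(2) cMm xc by (simp add: G.m_assoc)
  then have xi: "?x [^]\<^bsub>G\<^esub> i \<in> M"
    using cM cMm subgroup.m_closed[OF sM] subgroup.m_inv_closed[OF sM] by metis
  have x3: "?x [^]\<^bsub>G\<^esub> (3 * j) \<in> M" for j :: nat
    using G.subgroup_nat_pow[OF sM x(2), of j] xc by (simp add: G.nat_pow_pow)
  have "3 dvd i"
  proof (rule ccontr)
    assume "\<not> 3 dvd i"
    then obtain j where "i * i = 1 + 3 * j" using square_eq_1_mod_3 by blast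
    then have "(?x [^]\<^bsub>G\<^esub> i) [^]\<^bsub>G\<^esub> i = ?x \<otimes>\<^bsub>G\<^esub> ?x [^]\<^bsub>G\<^esub> (3 * j)"
      using xc G.nat_pow_Suc2[OF xc, of "3 * j"] by (metis G.nat_pow_pow mult.commute plus_1_eq_Suc)
    then have "?x = (?x [^]\<^bsub>G\<^esub> i) [^]\<^bsub>G\<^esub> i \<otimes>\<^bsub>G\<^esub> inv\<^bsub>G\<^esub> (?x [^]\<^bsub>G\<^esub> (3 * j))"
      using G.inv_solve_right[of ?x "(?x [^]\<^bsub>G\<^esub> i) [^]\<^bsub>G\<^esub> i" "?x [^]\<^bsub>G\<^esub> (3 * j)"] xc
      by (metis G.nat_pow_closed)
    moreover have "(?x [^]\<^bsub>G\<^esub> i) [^]\<^bsub>G\<^esub> i \<in> M" by (rule G.subgroup_nat_pow[OF sM xi])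
    ultimately show False
      using x(1) x3[of j] subgroup.m_closed[OF sM] subgroup.m_inv_closed[OF sM] by metis
  qed
  then show ?thesis using c by (metis dvdE)
qed

section \<open>Descent from G' to the trivial subgroup\<close>

context
  assumes nilpotent: "nilpotent_group G" and char: "ring_char K = 3"
begin

text \<open>Induction on the 3-logarithm k of the index of N in G', through a central extension B of
  N used for both claims. The case k = 0 is set apart because 3^0 - 1 is not a commutator length.
  For k > 0 either a gain has been made, or G'/N is still cyclic and generated by a
  commutator.\<close>

lemma lie_commutators_dichotomy:
  assumes fin: "finite (derived G (carrier G))" and m: "card (derived G (carrier G)) = 3 ^ m"
    and "N \<lhd> G" "N \<subseteq> derived G (carrier G)" "card (derived G (carrier G)) = 3 ^ k * card N"
  shows "lie_commutators A (3 ^ k + 1) \<subseteq> Aug N \<and>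
    (k = 0 \<or> lie_commutators A (3 ^ k - 1) \<subseteq> Aug N \<or> (\<exists>a b M. cyclic_derived_modulo N k a b M))"
  using assms(3-5)
proof (induction k arbitrary: N)
  let ?H = "derived G (carrier G)"
  case 0
  then have "N = ?H" using fin by (intro card_subset_eq) auto
  then show ?case using lie_commutators_two_Aug_derived by (simp add: numeral_2_eq_2[symmetric])
next
  let ?H = "derived G (carrier G)"
  case (Suc k)
  note three = three_eq_zero[OF char]
  have H: "?H \<lhd> G" by (rule G.normal_derived)
  have sH: "subgroup ?H G" and sN: "subgroup N G"
    using normal_imp_subgroup H Suc.prems(1) by auto
  have "card N > 0"
    using m Suc.prems(3) by (metis gr0I mult_0_right power_not_zero zero_neq_numeral)
  moreover have "(1::nat) < 3 ^ Suc k" by (rule one_less_power) simp_all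
  ultimately have lt: "card N < card ?H"
    unfolding Suc.prems(3) using mult_strict_right_mono[of 1 "3 ^ Suc k" "card N"] by simp
  then have "N \<subset> ?H" using Suc.prems(2) by auto
  then obtain z B where ext: "G.central_extension_by_3 N z B" and zH: "z \<in> ?H" and BH: "B \<subseteq> ?H"
    using G.exists_central_extension_by_3[OF nilpotent Suc.prems(1) H _ m] by blast
  note B = G.ext_normal[OF ext] and cardB = G.ext_card[OF ext] and NB = G.ext_superset[OF ext]
  note z = G.ext_facts[OF ext]
  have cardH: "card ?H = 3 ^ k * card B" using Suc.prems(3) cardB by simp
  have step: "lie_commutators A (Suc (3 * (l - 1))) \<subseteq> Aug N"
    if "0 < l" "lie_commutators A l \<subseteq> Aug B" for l
    by (rule lie_commutators_central_step[OF z(4) z(6) z(7) z(3) _ three that]) (use z(8) in blast)+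
  have upper: "lie_commutators A (3 ^ Suc k + 1) \<subseteq> Aug N"
    using step[of "3 ^ k + 1"] Suc.IH[OF B BH cardH] by simp
  have "lie_commutators A (3 ^ Suc k - 1) \<subseteq> Aug N \<or> (\<exists>a b M. cyclic_derived_modulo N (Suc k) a b M)"
  proof (cases "k = 0")
    case True
    then have BeqH: "B = ?H" using cardH fin BH by (intro card_subset_eq) auto
    \<comment> \<open>Otherwise all generators of G' would lie in N. Here N has index 3 in G', so
      the commutator found generates G' modulo N, and N itself is taken for M.\<close>
    have "\<exists>a \<in> carrier G. \<exists>b \<in> carrier G. G.comm a b \<notin> N"
    proof (rule ccontr)
      assume none: "\<not> ?thesis"
      have "?H \<subseteq> N"
        unfolding derived_def by (rule G.generate_subgroup_incl[OF _ sN]) (use none in blast)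
      then show False using lt card_mono[of N ?H] Suc.prems(2) fin finite_subset by fastforce
    qed
    then obtain a b where ab: "a \<in> carrier G" "b \<in> carrier G" "G.comm a b \<notin> N" by blast
    let ?x = "G.comm a b"
    have xB: "?x \<in> B" unfolding BeqH by (rule G.comm_in_derived[OF ab(1,2)])
    have "?x [^]\<^bsub>G\<^esub> (3::nat) \<in> N" by (rule G.ext_cube[OF ext xB])
    then have "cyclic_derived_modulo N (Suc k) a b N"
      unfolding cyclic_derived_modulo_def
      using ab Suc.prems(1) G.ext_comm[OF ext] BeqH G.ext_generated[OF ext xB ab(3)] True by simp
    then show ?thesis by blast
  next
    case False
    then have k3: "3 \<le> (3::nat) ^ k" using power_increasing[of 1 k "3::nat"] by simp
    from False Suc.IH[OF B BH cardH] consider "lie_commutators A (3 ^ k - 1) \<subseteq> Aug B"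
      | a b M where "cyclic_derived_modulo B k a b M" by blast
    then show ?thesis
    proof cases
      case 1
      \<comment> \<open>This length is 3^(k+1) - 5, below the target 3^(k+1) - 1.\<close>
      have "lie_commutators A (Suc (3 * ((3 ^ k - 1) - 1))) \<subseteq> Aug N"
        using step[OF _ 1] k3 by simp
      then have "lie_commutators A (3 ^ Suc k - 1) \<subseteq> Aug N"
        by (rule A.lie_commutators_mono[OF ideal_Aug, rotated 2]) (use k3 in auto)
      then show ?thesis ..
    next
      case 2
      let ?x = "G.comm a b"
      have ab: "a \<in> carrier G" "b \<in> carrier G" and M: "M \<lhd> G" "B \<subseteq> M"
        and xk: "?x [^]\<^bsub>G\<^esub> (3 ^ k :: nat) \<in> B"
        using 2 unfolding cyclic_derived_modulo_def by auto
      have gen: "\<exists>i::nat. \<exists>c \<in> B. h = ?x [^]\<^bsub>G\<^esub> i \<otimes>\<^bsub>G\<^esub> c" if "h \<in> ?H" for h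
        using 2 that unfolding cyclic_derived_modulo_def by blast
      have xc: "?x \<in> carrier G" using ab by simp
      show ?thesis
      \<comment> \<open>B/N has order 3. If x^(3^k) lies outside N it generates B/N, and G'/N stays
        cyclic; if it lies in N, generating G'/N takes z in addition to x.\<close>
      proof (cases "?x [^]\<^bsub>G\<^esub> (3 ^ k :: nat) \<in> N")
        case True
        have "lie_commutators A (3 ^ k + 5) \<subseteq> Aug N"
        proof (rule lie_commutators_noncyclic_step[OF xc z(4) z(6) True z(7) z(3) _ _ three])
          have split: "\<exists>(j::nat). \<exists>d\<in>N. ?x [^]\<^bsub>G\<^esub> (i::nat) \<otimes>\<^bsub>G\<^esub> c = ?x [^]\<^bsub>G\<^esub> i \<otimes>\<^bsub>G\<^esub> z [^]\<^bsub>G\<^esub> j \<otimes>\<^bsub>G\<^esub> d"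
            if "c \<in> B" for c i
          proof -
            obtain j :: nat and d where d: "d \<in> N" "c = z [^]\<^bsub>G\<^esub> j \<otimes>\<^bsub>G\<^esub> d"
              using z(8) \<open>c \<in> B\<close> by blast
            have "?x [^]\<^bsub>G\<^esub> i \<otimes>\<^bsub>G\<^esub> c = ?x [^]\<^bsub>G\<^esub> i \<otimes>\<^bsub>G\<^esub> z [^]\<^bsub>G\<^esub> j \<otimes>\<^bsub>G\<^esub> d"
              unfolding d(2)
              using G.m_assoc[OF G.nat_pow_closed[OF xc] G.nat_pow_closed[OF z(4)] subsetD[OF z(3) d(1)]]
              by simp
            then show ?thesis using d(1) by blast
          qed
          show "\<exists>(i::nat) (j::nat). \<exists>d\<in>N. G.comm g h = ?x [^]\<^bsub>G\<^esub> i \<otimes>\<^bsub>G\<^esub> z [^]\<^bsub>G\<^esub> j \<otimes>\<^bsub>G\<^esub> d"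
            if "g \<in> carrier G" "h \<in> carrier G" for g h
            using gen[OF G.comm_in_derived[OF that]] split by metis
          show "\<exists>(i::nat) (j::nat). \<exists>d\<in>N. G.comm ?x g = ?x [^]\<^bsub>G\<^esub> (3 * i) \<otimes>\<^bsub>G\<^esub> z [^]\<^bsub>G\<^esub> j \<otimes>\<^bsub>G\<^esub> d"
            if "g \<in> carrier G" for g
            using cyclic_derived_modulo_comm[OF 2 that] split by metis
        qed
        then have "lie_commutators A (3 ^ Suc k - 1) \<subseteq> Aug N"
          by (rule A.lie_commutators_mono[OF ideal_Aug, rotated 2]) (use k3 in auto)
        then show ?thesis ..
      next
        case False
        let ?w = "?x [^]\<^bsub>G\<^esub> (3 ^ k :: nat)"
        have "\<exists>i::nat. \<exists>c \<in> N. h = ?x [^]\<^bsub>G\<^esub> i \<otimes>\<^bsub>G\<^esub> c" if h: "h \<in> ?H" for h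
        proof -
          obtain i :: nat and c where c: "c \<in> B" "h = ?x [^]\<^bsub>G\<^esub> i \<otimes>\<^bsub>G\<^esub> c" using gen[OF h] by blast
          obtain j :: nat and d where d: "d \<in> N" "c = ?w [^]\<^bsub>G\<^esub> j \<otimes>\<^bsub>G\<^esub> d"
            using G.ext_generated[OF ext xk False c(1)] by blast
          have "h = ?x [^]\<^bsub>G\<^esub> (i + 3 ^ k * j) \<otimes>\<^bsub>G\<^esub> d"
            unfolding c(2) d(2) using xc subsetD[OF z(3) d(1)]
            by (simp only: G.nat_pow_pow G.nat_pow_mult[symmetric] G.m_assoc G.nat_pow_closed)
          then show ?thesis using d(1) by blast
        qed
        moreover have "?x [^]\<^bsub>G\<^esub> (3 ^ Suc k :: nat) \<in> N"
          using G.ext_cube[OF ext xk] G.nat_pow_pow[OF xc, of "3 ^ k" 3] by (simp only: power_Suc mult.commute)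
        \<comment> \<open>The same M remains valid, since only N has shrunk.\<close>
        ultimately have "cyclic_derived_modulo N (Suc k) a b M"
          using 2 NB unfolding cyclic_derived_modulo_def by blast
        then show ?thesis by blast
      qed
    qed
  qed
  then show ?case using upper by blast
qed

text \<open>The dichotomy is applied to the trivial subgroup, whose augmentation ideal is 0: either
  commutators of length 3^n - 1 already vanish, or those of length 3^n do not all vanish.\<close>

lemma lie_nilpotency_index_gap:
  assumes card: "card (derived G (carrier G)) = 3 ^ n"
  shows "lie_nilpotency_index A \<le> 3 ^ n - 1 \<or> 3 ^ n < lie_nilpotency_index A"
proof -
  let ?H = "derived G (carrier G)" and ?t = "lie_nilpotency_index A"
  let ?P = "\<lambda>m. 1 \<le> m \<and> lie_commutators A m \<subseteq> {\<zero>\<^bsub>A\<^esub>}"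
  have t_def: "?t = (LEAST m. ?P m)"
    unfolding lie_nilpotency_index_def by (intro arg_cong[of _ _ Least] ext conj_cong refl A.lower_lie_power_eq_zero_iff)
  have fin: "finite ?H" using card by (intro card_ge_0_finite) simp
  have one: "{\<one>\<^bsub>G\<^esub>} \<lhd> G" "{\<one>\<^bsub>G\<^esub>} \<subseteq> ?H"
    using G.one_is_normal subgroup.one_closed[OF G.derived_is_subgroup] by auto
  have dich: "lie_commutators A (3 ^ n + 1) \<subseteq> {\<zero>\<^bsub>A\<^esub>}"
    "n = 0 \<or> lie_commutators A (3 ^ n - 1) \<subseteq> {\<zero>\<^bsub>A\<^esub>} \<or> (\<exists>a b M. cyclic_derived_modulo {\<one>\<^bsub>G\<^esub>} n a b M)"
    using lie_commutators_dichotomy[OF fin card one, of n] card unfolding Aug_one by auto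
  \<comment> \<open>The length 3^n + 1 is the witness that makes the least index attained.\<close>
  have P: "?P ?t" unfolding t_def by (rule LeastI[of ?P "3 ^ n + 1"]) (use dich in simp)
  have not_P: "3 ^ n < ?t" if "\<not> lie_commutators A (3 ^ n) \<subseteq> {\<zero>\<^bsub>A\<^esub>}"
  proof (rule ccontr)
    assume "\<not> ?thesis"
    then have "lie_commutators A (3 ^ n) \<subseteq> {\<zero>\<^bsub>A\<^esub>}"
      using A.lie_commutators_mono[OF A.zeroideal, of ?t "3 ^ n"] P by simp
    then show False using that by blast
  qed
  consider "n = 0" | "n \<noteq> 0" "lie_commutators A (3 ^ n - 1) \<subseteq> {\<zero>\<^bsub>A\<^esub>}"
    | a b M where "cyclic_derived_modulo {\<one>\<^bsub>G\<^esub>} n a b M" using dich(2) by blast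
  then show ?thesis
  proof cases
    case 1
    \<comment> \<open>For n = 0 the commutators of length 1 are all elements, including 1.\<close>
    have "\<one>\<^bsub>A\<^esub> \<in> lie_commutators A (3 ^ n)"
      unfolding 1 lie_commutators_def by (auto intro!: exI[of _ "\<one>\<^bsub>A\<^esub>"])
    then have "3 ^ n < ?t" using one_neq_zero by (intro not_P) blast
    then show ?thesis by simp
  next
    case 2
    have "3 \<le> (3::nat) ^ n" using 2(1) power_increasing[of 1 n "3::nat"] by simp
    then have "?t \<le> 3 ^ n - 1" unfolding t_def by (intro Least_le) (use 2 in simp)
    then show ?thesis using \<open>3 \<le> 3 ^ n\<close> by linarith
  next
    case (3 a b M)
    let ?x = "G.comm a b"
    have ab: "a \<in> carrier G" "b \<in> carrier G" and xn: "?x [^]\<^bsub>G\<^esub> (3 ^ n :: nat) = \<one>\<^bsub>G\<^esub>"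
      using 3 unfolding cyclic_derived_modulo_def by auto
    have xc: "?x \<in> carrier G" using ab by simp
    have gen: "\<exists>i::nat. h = ?x [^]\<^bsub>G\<^esub> i" if "h \<in> ?H" for h
    proof -
      from 3 have "\<forall>h \<in> ?H. \<exists>i::nat. \<exists>c \<in> {\<one>\<^bsub>G\<^esub>}. h = ?x [^]\<^bsub>G\<^esub> i \<otimes>\<^bsub>G\<^esub> c"
        unfolding cyclic_derived_modulo_def by (elim conjE)
      from bspec[OF this that] obtain i :: nat where "h = ?x [^]\<^bsub>G\<^esub> i \<otimes>\<^bsub>G\<^esub> \<one>\<^bsub>G\<^esub>"
        unfolding bex_simps by (elim exE bexE) simp
      then show ?thesis using xc by (metis G.nat_pow_closed G.r_one)
    qed
    have "(\<lambda>i::nat. ?x [^]\<^bsub>G\<^esub> i) ` {..<3 ^ n} = ?H"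
    proof
      show "(\<lambda>i::nat. ?x [^]\<^bsub>G\<^esub> i) ` {..<3 ^ n} \<subseteq> ?H"
        using G.subgroup_nat_pow[OF G.derived_is_subgroup G.comm_in_derived[OF ab]] by blast
      show "?H \<subseteq> (\<lambda>i::nat. ?x [^]\<^bsub>G\<^esub> i) ` {..<3 ^ n}"
      proof
        fix h assume "h \<in> ?H"
        then obtain i :: nat where i: "h = ?x [^]\<^bsub>G\<^esub> i" using gen by blast
        have "?x [^]\<^bsub>G\<^esub> i = (?x [^]\<^bsub>G\<^esub> (3 ^ n :: nat)) [^]\<^bsub>G\<^esub> (i div 3 ^ n) \<otimes>\<^bsub>G\<^esub> ?x [^]\<^bsub>G\<^esub> (i mod 3 ^ n)"
          using G.nat_pow_pow[OF xc] G.nat_pow_mult[OF xc] mult_div_mod_eq by metis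
        then have "h = ?x [^]\<^bsub>G\<^esub> (i mod 3 ^ n)"
          unfolding i xn using G.nat_pow_closed[OF xc] G.nat_pow_one G.l_one by metis
        then show "h \<in> (\<lambda>i::nat. ?x [^]\<^bsub>G\<^esub> i) ` {..<3 ^ n}" by auto
      qed
    qed
    \<comment> \<open>3^n exponents map onto a set of 3^n elements, so x has order exactly
      3^n.\<close>
    then have inj: "inj_on (\<lambda>i::nat. ?x [^]\<^bsub>G\<^esub> i) {..<3 ^ n}"
      using card by (intro eq_card_imp_inj_on) auto
    have "\<not> lie_commutators A (3 ^ n) \<subseteq> {\<zero>\<^bsub>A\<^esub>}"
    proof (rule lie_commutators_cyclic_nonzero[OF ab refl inj xn _ _ three_eq_zero[OF char]])
      show "\<exists>i::nat. G.comm g h = ?x [^]\<^bsub>G\<^esub> i" if "g \<in> carrier G" "h \<in> carrier G" for g h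
        using gen[OF G.comm_in_derived[OF that]] .
      show "\<exists>i::nat. G.comm ?x g = ?x [^]\<^bsub>G\<^esub> (3 * i)" if "g \<in> carrier G" for g
        using cyclic_derived_modulo_comm[OF 3 that] xc by (metis G.nat_pow_closed G.r_one singletonD)
    qed
    then have "3 ^ n < ?t" by (rule not_P)
    then show ?thesis by simp
  qed
qed

end

end

theorem corollary1:
  fixes K :: "('k, 'c) ring_scheme" and G :: "('g, 'd) monoid_scheme" and p n :: nat
  assumes "field K" and "ring_char K = p" and "p > 0"
    and "nilpotent_group G"
    and "card (derived G (carrier G)) = p ^ n"
  shows "(p = 2 \<longrightarrow> lie_nilpotency_index (group_algebra K G) < 2 ^ n + 1 \<longrightarrow>
            lie_nilpotency_index (group_algebra K G) \<le> 2 ^ n) \<and>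
         (p = 3 \<longrightarrow> lie_nilpotency_index (group_algebra K G) < 3 ^ n + 1 \<longrightarrow>
            lie_nilpotency_index (group_algebra K G) \<le> 3 ^ n - 1)"
proof (intro conjI impI)
  assume p: "p = 3" and t: "lie_nilpotency_index (group_algebra K G) < 3 ^ n + 1"
  have "group G" using assms(4) by (simp add: nilpotent_group_def)
  then interpret group_algebra_over_field K G
    using assms(1) by (simp add: group_algebra_over_field_def)
  show "lie_nilpotency_index (group_algebra K G) \<le> 3 ^ n - 1"
    using lie_nilpotency_index_gap[of n] assms(2,4,5) p t by auto
\<comment> \<open>Part (i) is arithmetic of natural numbers: t < 2^n + 1 means t <= 2^n.\<close>
qed simp

end
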